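(* Let $n\geq1$ be an integer. Let $q>0$ be a continuous function on $[t_0,\infty)$ and let $A>0$ be given by $$A(t)=A(t_0)\exp\left(\int_{t_0}^t\frac{\mathrm{d}s}{q(s)}\right),\qquad t\in[t_0,\infty),$$ with inverse function $f$. If $q$ is $(n-1)$-times continuously differentiable, then the functions $L_0=f$, $L_i(t)=t\,DL_{i-1}(t)$, $i\in\{1,\ldots,n\}$, are well-defined and given by $L_i=q_i\circ f$ for $i\in\{1,\ldots,n\}$, where $q_1=q$ and $q_i=q\,Dq_{i-1}$ for $i\in\{2,\ldots,n\}$. Assume further that $Dq(t)=o(1)$ as $t\to\infty$, that $D^{n-1}q$ is eventually of constant sign and that $|D^{n-1}q|$ is regularly varying of index $\alpha-n+1$ for some $\alpha\leq1$. If $\alpha$ is not of the form $(m-1)/m$ for some integer $m\in\{2,\ldots,n-1\}$, then $L_n$ is eventually of constant sign too and $|L_n|$ is slowly varying. As a consequence, $f\in\Pi((L_1,\ldots,L_n)')$ with index $\boldsymbol{c}=(1,0,\ldots,0)$.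
   Context: $D$ denotes the differential operator. Limit relations are as $t\to\infty$; measurability is Lebesgue. A positive measurable function $F$ defined in a neighbourhood of infinity is regularly varying of index $\rho\in\mathbb{R}$ if $F(xt)/F(t)\to x^\rho$ for every $x>0$, and slowly varying if $\rho=0$. The functions $L_i$ are considered on the domain of $f$ (the range of $A$). A real function is defined in a neighbourhood of infinity if its domain contains some $[t_0,\infty)$; it is eventually of constant sign if it is either strictly positive for all large $t$ or strictly negative for all large $t$. A rate vector of length $n$ is a column vector $\boldsymbol{g}=(g_1,\ldots,g_n)'$ (prime denotes transpose) of real-valued functions defined in a neighbourhood of infinity, each eventually of constant sign, with $g_{i+1}(t)=o(g_i(t))$ for every $i\in\{1,\ldots,n-1\}$; $o(g_n(t))$ means $o(|g_n(t)|)$, componentwise for vectors. For a square matrix $\boldsymbol{B}$ and $x>0$, $x^{\boldsymbol{B}}=\exp\{(\log x)\boldsymbol{B}\}$. A rate vector $\boldsymbol{g}$ is regularly varying with index matrix $\boldsymbol{B}$ if $\boldsymbol{g}$ is measurable and $\boldsymbol{g}(xt)=x^{\boldsymbol{B}}\boldsymbol{g}(t)+o(g_n(t))$ for every $x\in(0,\infty)$; here an index matrix is an upper triangular $\boldsymbol{B}\in\mathbb{R}^{n\times n}$ with non-increasing diagonal elements and all of whose eigenvalues, except possibly the smallest one, have geometric multiplicity one. For a rate vector $\boldsymbol{g}$ regularly varying with an index matrix $\boldsymbol{B}$ having zero diagonal, $f\in\Pi(\boldsymbol{g})$ with ($\boldsymbol{g}$-)index $\boldsymbol{c}\in\mathbb{R}^{1\times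 n}$ means that $f$ is a measurable real-valued function defined in a neighbourhood of infinity and for every $x\in(0,\infty)$, $f(xt)=f(t)+\boldsymbol{h}(x)\boldsymbol{g}(t)+o(g_n(t))$ with $\boldsymbol{h}(x)=\boldsymbol{c}\int_1^x y^{\boldsymbol{B}}y^{-1}\,\mathrm{d}y$. In the theorem, the index matrix of $(L_1,\ldots,L_n)'$ is the Jordan block $\boldsymbol{J}_n$ with $(\boldsymbol{J}_n)_{i,i+1}=1$ and all other entries zero. *)

theory Defs
  imports
    "HOL-Analysis.Analysis"
    "HOL-Library.Landau_Symbols"
    "Jordan_Normal_Form.Jordan_Normal_Form"
    "Jordan_Normal_Form.Matrix_Kernel"
begin

unbundle no vec_syntax
unbundle no inner_syntax

text \<open>
  A partial real function is represented by a total function together with its domain \<open>S\<close>;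
  values outside \<open>S\<close> are irrelevant to all notions below.
\<close>

definition nbhd_of_infinity :: "real set \<Rightarrow> bool" where
  "nbhd_of_infinity S \<longleftrightarrow> (\<exists>a. {a..} \<subseteq> S)"

definition measurable_fun_on :: "real set \<Rightarrow> (real \<Rightarrow> real) \<Rightarrow> bool" where
  "measurable_fun_on S F \<longleftrightarrow> S \<in> sets lebesgue \<and> F \<in> borel_measurable (lebesgue_on S)"

definition eventually_const_sign :: "(real \<Rightarrow> real) \<Rightarrow> bool" where
  "eventually_const_sign F \<longleftrightarrow>
     eventually (\<lambda>t. F t > 0) at_top \<or> eventually (\<lambda>t. F t < 0) at_top"


subsection \<open>Derivatives relative to a domain\<close>

text \<open>The derivative is one-sided at an endpoint belonging to \<open>S\<close>.\<close>

definition deriv_on :: "real set \<Rightarrow> (real \<Rightarrow> real) \<Rightarrow> real \<Rightarrow> real" where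
  "deriv_on S F = (\<lambda>t. vector_derivative F (at t within S))"

definition times_cont_differentiable_on :: "nat \<Rightarrow> real set \<Rightarrow> (real \<Rightarrow> real) \<Rightarrow> bool" where
  "times_cont_differentiable_on k S F \<longleftrightarrow>
     (\<forall>j<k. (deriv_on S ^^ j) F differentiable_on S) \<and> continuous_on S ((deriv_on S ^^ k) F)"


subsection \<open>Regular variation\<close>

text \<open>Positivity is only required near infinity, as for all other asymptotic conditions.\<close>

definition regularly_varying :: "real set \<Rightarrow> (real \<Rightarrow> real) \<Rightarrow> real \<Rightarrow> bool" where
  "regularly_varying S F \<rho> \<longleftrightarrow>
     nbhd_of_infinity S \<and> measurable_fun_on S F \<and> eventually (\<lambda>t. F t > 0) at_top \<and>
     (\<forall>x>0. ((\<lambda>t. F (x * t) / F t) \<longlongrightarrow> x powr \<rho>) at_top)"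

definition slowly_varying :: "real set \<Rightarrow> (real \<Rightarrow> real) \<Rightarrow> bool" where
  "slowly_varying S F \<longleftrightarrow> regularly_varying S F 0"


subsection \<open>Rate vectors\<close>

text \<open>
  Vector and matrix entries are indexed from \<open>0\<close>: the component \<open>g\<^sub>i\<close> of a rate vector
  \<open>g\<close> is \<open>\<lambda>t. g t $ (i - 1)\<close>.
\<close>

definition rate_vector :: "nat \<Rightarrow> real set \<Rightarrow> (real \<Rightarrow> real vec) \<Rightarrow> bool" where
  "rate_vector n S g \<longleftrightarrow>
     n \<ge> 1 \<and> nbhd_of_infinity S \<and> (\<forall>t\<in>S. g t \<in> carrier_vec n) \<and>
     (\<forall>i<n. eventually_const_sign (\<lambda>t. g t $ i)) \<and>
     (\<forall>i. Suc i < n \<longrightarrow> (\<lambda>t. g t $ Suc i) \<in> o[at_top](\<lambda>t. g t $ i))"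

definition mat_exp :: "real mat \<Rightarrow> real mat" where
  "mat_exp B = mat (dim_row B) (dim_row B) (\<lambda>(i, j). \<Sum>k. (B ^\<^sub>m k) $$ (i, j) / fact k)"

definition powr_mat :: "real \<Rightarrow> real mat \<Rightarrow> real mat" where
  "powr_mat x B = mat_exp (ln x \<cdot>\<^sub>m B)"

definition geometric_multiplicity :: "real mat \<Rightarrow> real \<Rightarrow> nat" where
  "geometric_multiplicity B ev = kernel_dim (char_matrix B ev)"

text \<open>All eigenvalues of an upper triangular real matrix are real.\<close>

definition index_matrix :: "nat \<Rightarrow> real mat \<Rightarrow> bool" where
  "index_matrix n B \<longleftrightarrow>
     B \<in> carrier_mat n n \<and> upper_triangular B \<and>
     (\<forall>i. Suc i < n \<longrightarrow> B $$ (Suc i, Suc i) \<le> B $$ (i, i)) \<and>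
     (\<forall>ev. eigenvalue B ev \<and> (\<exists>ev'. eigenvalue B ev' \<and> ev' < ev)
        \<longrightarrow> geometric_multiplicity B ev = 1)"

definition regularly_varying_vec ::
    "nat \<Rightarrow> real set \<Rightarrow> (real \<Rightarrow> real vec) \<Rightarrow> real mat \<Rightarrow> bool" where
  "regularly_varying_vec n S g B \<longleftrightarrow>
     rate_vector n S g \<and> index_matrix n B \<and>
     (\<forall>i<n. measurable_fun_on S (\<lambda>t. g t $ i)) \<and>
     (\<forall>x>0. \<forall>i<n. (\<lambda>t. (g (x * t) - powr_mat x B *\<^sub>v g t) $ i) \<in> o[at_top](\<lambda>t. g t $ (n - 1)))"


subsection \<open>The class \<open>\<Pi>(g)\<close>\<close>

text \<open>
  The matrix \<open>\<integral>\<^sub>1\<^sup>x y\<^sup>B y\<^sup>-\<^sup>1 dy\<close>, entrywise and oriented, i.e. minus the integral over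
  \<open>[x, 1]\<close> if \<open>x < 1\<close>.
\<close>

definition powr_mat_integral :: "real \<Rightarrow> real mat \<Rightarrow> real mat" where
  "powr_mat_integral x B =
     mat (dim_row B) (dim_row B) (\<lambda>(i, j). LBINT y=ereal 1..ereal x. powr_mat y B $$ (i, j) / y)"

text \<open>The row vector \<open>h(x)\<close>; multiplying by \<open>c\<close> from the left becomes a transpose.\<close>

definition Pi_h :: "real vec \<Rightarrow> real mat \<Rightarrow> real \<Rightarrow> real vec" where
  "Pi_h c B x = transpose_mat (powr_mat_integral x B) *\<^sub>v c"

text \<open>
  \<open>Pi_class n T f S g B c\<close>: \<open>f\<close> (with domain \<open>T\<close>) belongs to \<open>\<Pi>(g)\<close> with index \<open>c\<close>, where \<open>g\<close>
  (with domain \<open>S\<close>) is a rate vector of length \<open>n\<close>, regularly varying with index matrix \<open>B\<close>.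
\<close>

definition Pi_class ::
    "nat \<Rightarrow> real set \<Rightarrow> (real \<Rightarrow> real) \<Rightarrow> real set \<Rightarrow> (real \<Rightarrow> real vec) \<Rightarrow> real mat \<Rightarrow> real vec \<Rightarrow> bool"
  where
  "Pi_class n T f S g B c \<longleftrightarrow>
     regularly_varying_vec n S g B \<and> (\<forall>i<n. B $$ (i, i) = 0) \<and> c \<in> carrier_vec n \<and>
     nbhd_of_infinity T \<and> measurable_fun_on T f \<and>
     (\<forall>x>0. (\<lambda>t. f (x * t) - f t - Pi_h c B x \<bullet> g t) \<in> o[at_top](\<lambda>t. g t $ (n - 1)))"

end

theory Submission
  imports Defs
begin

text \<open>
  Since \<open>A' = A/q\<close>, the inverse satisfies \<open>y f'(y) = q(f(y))\<close>, so \<open>y D\<close> acts on functions of the form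
  \<open>F \<circ> f\<close> as \<open>q D\<close> acts on \<open>F\<close>; hence \<open>L\<^sub>i = q\<^sub>i \<circ> f\<close>.

  For the asymptotics, \<open>Dq \<rightarrow> 0\<close> forces \<open>D\<^sup>k q \<rightarrow> 0\<close> for \<open>1 \<le> k \<le> n - 2\<close>, and Karamata's theorem gives
  \<open>t D\<^sup>k\<^sup>+\<^sup>1 q / D\<^sup>k q \<rightarrow> \<alpha> - k\<close> for these \<open>k\<close>. For \<open>k = 0\<close> the limit is some \<open>\<beta>\<close> with
  \<open>\<beta> = \<alpha>\<close>, or \<open>\<beta> = 0\<close> and \<open>\<alpha> \<le> 0\<close> (when \<open>q\<close> has a positive limit). With \<open>\<theta> = t D\<close>, the functions
  \<open>v\<^sub>i = \<theta> q\<^sub>i / q\<^sub>i\<close> satisfy \<open>q\<^sub>i\<^sub>+\<^sub>1 = (q / t) q\<^sub>i v\<^sub>i\<close> and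
  \<open>v\<^sub>i\<^sub>+\<^sub>1 = v\<^sub>i + \<theta> q / q - 1 + \<theta> v\<^sub>i / v\<^sub>i\<close>, whence \<open>v\<^sub>i \<rightarrow> (i - 1) \<beta> + \<alpha> - (i - 1)\<close> for
  \<open>2 \<le> i \<le> n - 1\<close>. These limits are nonzero exactly because \<open>\<alpha>\<close> avoids the excluded values.
  So \<open>q\<^sub>n\<close> is of constant sign and hardly changes under \<open>t \<mapsto> (1 + o(1)) t\<close>; as \<open>q(t) = o(t)\<close>, \<open>f\<close> is
  slowly varying, and \<open>L\<^sub>n\<close> inherits slow variation. Membership in the class \<open>\<Pi>\<close> is then
  Taylor's formula for \<open>s \<mapsto> L\<^sub>i(exp s)\<close> with Lagrange remainder.
\<close>

subsection \<open>Slow oscillation and the uniform convergence theorem\<close>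

text \<open>The uniform convergence theorem for slowly varying functions in additive form, by Baire
  category: continuity makes the sets \<open>E N\<close> closed, they cover the line, so one of them
  contains a ball, and differences of two shifts from that ball are shifts near 0.\<close>

lemma uniform_convergence_additive:
  fixes g :: "real \<Rightarrow> real"
  assumes cont: "continuous_on UNIV g"
    and lim: "\<And>u. ((\<lambda>s. g (s + u) - g s) \<longlongrightarrow> 0) at_top"
    and "\<epsilon> > 0"
  shows "\<exists>\<delta>>0. eventually (\<lambda>s. \<forall>u. \<bar>u\<bar> \<le> \<delta> \<longrightarrow> \<bar>g (s + u) - g s\<bar> \<le> \<epsilon>) at_top"
proof -
  define e where "e = \<epsilon> / 2"
  have "e > 0" using \<open>\<epsilon> > 0\<close> by (simp add: e_def)
  define E where "E = (\<lambda>N::nat. {u. \<forall>s\<ge>real N. \<bar>g (s + u) - g s\<bar> \<le> e})"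
  have closed: "closed (E N)" for N
  proof -
    have "E N = (\<Inter>s\<in>{real N..}. {u. \<bar>g (s + u) - g s\<bar> \<le> e})"
      by (auto simp: E_def)
    moreover have "closed {u. \<bar>g (s + u) - g s\<bar> \<le> e}" for s
      by (intro closed_Collect_le continuous_intros continuous_on_compose2[OF cont]) auto
    ultimately show ?thesis by (auto intro!: closed_INT)
  qed
  have cover: "\<exists>N. u \<in> E N" for u
  proof -
    have "eventually (\<lambda>s. \<bar>g (s + u) - g s\<bar> < e) at_top"
      using tendstoD[OF lim[of u] \<open>e > 0\<close>] by (simp add: dist_real_def)
    then obtain M where M: "\<And>s. s \<ge> M \<Longrightarrow> \<bar>g (s + u) - g s\<bar> < e"
      by (auto simp: eventually_at_top_linorder)
    obtain N :: nat where "M \<le> real N" using real_arch_simple by blast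
    then show ?thesis using M unfolding E_def by (auto intro!: exI[of _ N] less_imp_le)
  qed
  have "\<exists>N. closure (- E N) \<noteq> UNIV"
  proof (rule ccontr)
    assume "\<not> ?thesis"
    then have dense: "closure (- E N) = UNIV" for N by blast
    have "UNIV \<subseteq> closure (\<Inter>(range (\<lambda>N. - E N)))"
      by (rule Baire) (use dense closed in \<open>auto simp: open_closed\<close>)
    moreover have "\<Inter>(range (\<lambda>N. - E N)) = {}" using cover by auto
    ultimately show False by simp
  qed
  then obtain N a where "a \<notin> closure (- E N)" by blast
  then obtain r where r: "r > 0" "ball a r \<subseteq> E N"
    using open_contains_ball[of "- closure (- E N)"] closure_subset[of "- E N"] by blast
  define \<delta> where "\<delta> = r / 2"
  have "\<delta> > 0" using r by (simp add: \<delta>_def)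
  moreover have "\<bar>g (s + u) - g s\<bar> \<le> \<epsilon>" if "\<bar>u\<bar> \<le> \<delta>" "s \<ge> real N + a" for s u
  proof -
    \<comment> \<open>Both \<open>a\<close> and \<open>a + u\<close> lie in the ball, so moving the
      base point back to \<open>s - a\<close> compares \<open>g (s + u)\<close> and
      \<open>g s\<close> with the same value; the two errors \<open>e\<close> add up to
      \<epsilon>.\<close>
    have "a + u \<in> E N" "a \<in> E N" using that r by (auto simp: \<delta>_def dist_real_def subset_iff)
    then have "\<bar>g ((s - a) + (a + u)) - g (s - a)\<bar> \<le> e" "\<bar>g ((s - a) + a) - g (s - a)\<bar> \<le> e"
      using that(2) unfolding E_def by (smt (verit) mem_Collect_eq)+
    moreover have "(s - a) + (a + u) = s + u" "(s - a) + a = s" by auto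
    ultimately show ?thesis unfolding e_def by (smt (verit) field_sum_of_halves)
  qed
  ultimately show ?thesis
    unfolding eventually_at_top_linorder by (intro exI[of _ \<delta>] conjI exI[of _ "real N + a"]) auto
qed

text \<open>A multiplicative form of uniform continuity at infinity, with the error measured
  relative to \<open>F t\<close>. It involves no index, allows either sign, is stable under products
  and transfers to the composition with a slowly varying inverse.\<close>

definition slowly_oscillating :: "(real \<Rightarrow> real) \<Rightarrow> bool" where
  "slowly_oscillating F \<longleftrightarrow> (\<forall>\<epsilon>>0. \<exists>\<delta>>0.
     eventually (\<lambda>t. \<forall>s. \<bar>s - t\<bar> \<le> \<delta> * t \<longrightarrow> \<bar>F s - F t\<bar> \<le> \<epsilon> * \<bar>F t\<bar>) at_top)"

text \<open>The window around \<open>t\<close> lies above \<open>(1 - \<delta>) * t\<close>, which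
  exceeds any threshold for large \<open>t\<close>.\<close>

lemma eventually_at_top_nearby:
  fixes P :: "real \<Rightarrow> bool"
  assumes "eventually P at_top" "\<delta> < 1"
  shows "eventually (\<lambda>t. \<forall>s. \<bar>s - t\<bar> \<le> \<delta> * t \<longrightarrow> P s) at_top"
proof -
  obtain T where T: "\<And>s. s \<ge> T \<Longrightarrow> P s" using assms by (auto simp: eventually_at_top_linorder)
  have "P s" if "t \<ge> \<bar>T\<bar> / (1 - \<delta>)" "\<bar>s - t\<bar> \<le> \<delta> * t" for s t
  proof (rule T)
    have "\<bar>T\<bar> \<le> t * (1 - \<delta>)" using that(1) assms(2) by (simp add: pos_divide_le_eq)
    moreover have "t - \<delta> * t \<le> s" using that(2) by (simp add: abs_le_iff)
    ultimately show "s \<ge> T" by (simp add: algebra_simps)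
  qed
  then show ?thesis by (auto simp: eventually_at_top_linorder)
qed

lemma slowly_oscillating_cong:
  assumes "slowly_oscillating F" "eventually (\<lambda>t. F t = G t) at_top"
  shows "slowly_oscillating G"
  unfolding slowly_oscillating_def
proof (intro allI impI)
  fix \<epsilon> :: real assume "\<epsilon> > 0"
  then obtain \<delta> where d: "\<delta> > 0"
    "eventually (\<lambda>t. \<forall>s. \<bar>s - t\<bar> \<le> \<delta> * t \<longrightarrow> \<bar>F s - F t\<bar> \<le> \<epsilon> * \<bar>F t\<bar>) at_top"
    using assms(1) unfolding slowly_oscillating_def by blast
  \<comment> \<open>The cap at 1/2 keeps the whole window in the region where \<open>F\<close> and
    \<open>G\<close> agree.\<close>
  define \<eta> where "\<eta> = min \<delta> (1/2)"
  have \<eta>: "\<eta> > 0" "\<eta> \<le> \<delta>" "\<eta> < 1" using d by (auto simp: \<eta>_def)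
  have "eventually (\<lambda>t. \<forall>s. \<bar>s - t\<bar> \<le> \<eta> * t \<longrightarrow> \<bar>G s - G t\<bar> \<le> \<epsilon> * \<bar>G t\<bar>) at_top"
    using d(2) assms(2) eventually_at_top_nearby[OF assms(2) \<eta>(3)] eventually_ge_at_top[of 0]
  proof eventually_elim
    case (elim t)
    have "\<eta> * t \<le> \<delta> * t" using \<eta> elim by (intro mult_right_mono) auto
    then have "\<bar>G s - G t\<bar> \<le> \<epsilon> * \<bar>G t\<bar>" if "\<bar>s - t\<bar> \<le> \<eta> * t" for s
    proof -
      have "\<bar>F s - F t\<bar> \<le> \<epsilon> * \<bar>F t\<bar>" using elim(1) that \<open>\<eta> * t \<le> \<delta> * t\<close> order_trans by blast
      moreover have "F s = G s" using elim(3) that by blast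
      ultimately show ?thesis using elim(2) by simp
    qed
    then show ?case by blast
  qed
  then show "\<exists>\<delta>>0. eventually (\<lambda>t. \<forall>s. \<bar>s - t\<bar> \<le> \<delta> * t \<longrightarrow> \<bar>G s - G t\<bar> \<le> \<epsilon> * \<bar>G t\<bar>) at_top"
    using \<eta> by blast
qed

lemma slowly_oscillating_mult:
  assumes "slowly_oscillating F" "slowly_oscillating G"
  shows "slowly_oscillating (\<lambda>t. F t * G t)"
  unfolding slowly_oscillating_def
proof (intro allI impI)
  fix \<epsilon> :: real assume "\<epsilon> > 0"
  \<comment> \<open>With this choice the three error terms sum to \<open>e * e + 2 * e\<close>, at
    most \<open>3 * e\<close>, hence at most \<epsilon>.\<close>
  define e where "e = min 1 (\<epsilon> / 3)"
  have e: "e > 0" "e \<le> 1" "3 * e \<le> \<epsilon>" using \<open>\<epsilon> > 0\<close> by (auto simp: e_def)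
  obtain \<delta>1 \<delta>2 where d: "\<delta>1 > 0" "\<delta>2 > 0"
    "eventually (\<lambda>t. \<forall>s. \<bar>s - t\<bar> \<le> \<delta>1 * t \<longrightarrow> \<bar>F s - F t\<bar> \<le> e * \<bar>F t\<bar>) at_top"
    "eventually (\<lambda>t. \<forall>s. \<bar>s - t\<bar> \<le> \<delta>2 * t \<longrightarrow> \<bar>G s - G t\<bar> \<le> e * \<bar>G t\<bar>) at_top"
    using assms[unfolded slowly_oscillating_def, rule_format, OF e(1)] by blast
  define \<eta> where "\<eta> = min \<delta>1 \<delta>2"
  have "eventually (\<lambda>t. \<forall>s. \<bar>s - t\<bar> \<le> \<eta> * t \<longrightarrow> \<bar>F s * G s - F t * G t\<bar> \<le> \<epsilon> * \<bar>F t * G t\<bar>) at_top"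
    using d(3,4) eventually_ge_at_top[of 0]
  proof eventually_elim
    case (elim t)
    show ?case
    proof (intro allI impI)
      fix s assume s: "\<bar>s - t\<bar> \<le> \<eta> * t"
      have "\<eta> * t \<le> \<delta>1 * t" "\<eta> * t \<le> \<delta>2 * t"
        using elim by (auto simp: \<eta>_def intro!: mult_right_mono)
      with s elim have F: "\<bar>F s - F t\<bar> \<le> e * \<bar>F t\<bar>" and G: "\<bar>G s - G t\<bar> \<le> e * \<bar>G t\<bar>"
        by auto
      have "F s * G s - F t * G t = (F s - F t) * (G s - G t) + F t * (G s - G t) + (F s - F t) * G t"
        by (simp add: algebra_simps)
      also have "\<bar>\<dots>\<bar> \<le> \<bar>F s - F t\<bar> * \<bar>G s - G t\<bar> + \<bar>F t\<bar> * \<bar>G s - G t\<bar> + \<bar>F s - F t\<bar> * \<bar>G t\<bar>"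
        by (simp flip: abs_mult)
      also have "\<dots> \<le> (e * \<bar>F t\<bar>) * (e * \<bar>G t\<bar>) + \<bar>F t\<bar> * (e * \<bar>G t\<bar>) + (e * \<bar>F t\<bar>) * \<bar>G t\<bar>"
        using F G e(1) by (intro add_mono mult_mono) auto
      also have "\<dots> = (e * e + 2 * e) * (\<bar>F t\<bar> * \<bar>G t\<bar>)" by (simp add: algebra_simps)
      also have "\<dots> \<le> \<epsilon> * (\<bar>F t\<bar> * \<bar>G t\<bar>)"
      proof (intro mult_right_mono)
        have "e * e \<le> e * 1" using e by (intro mult_left_mono) auto
        then show "e * e + 2 * e \<le> \<epsilon>" using e(3) by simp
      qed auto
      finally show "\<bar>F s * G s - F t * G t\<bar> \<le> \<epsilon> * \<bar>F t * G t\<bar>" by (simp add: abs_mult)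
    qed
  qed
  moreover have "\<eta> > 0" using d by (simp add: \<eta>_def)
  ultimately show "\<exists>\<delta>>0. eventually (\<lambda>t. \<forall>s. \<bar>s - t\<bar> \<le> \<delta> * t \<longrightarrow>
      \<bar>F s * G s - F t * G t\<bar> \<le> \<epsilon> * \<bar>F t * G t\<bar>) at_top" by blast
qed

text \<open>The nonzero limit bounds \<open>\<bar>F t\<bar>\<close> below by
  \<open>\<bar>c\<bar> / 2\<close>, so a small absolute oscillation is also small relative to
  \<open>F t\<close>.\<close>

lemma slowly_oscillating_tendsto:
  assumes "(F \<longlongrightarrow> c) at_top" "c \<noteq> 0"
  shows "slowly_oscillating F"
  unfolding slowly_oscillating_def
proof (intro allI impI)
  fix \<epsilon> :: real assume "\<epsilon> > 0"
  define e where "e = min (\<bar>c\<bar> / 2) (\<epsilon> * \<bar>c\<bar> / 4)"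
  have e: "e > 0" "e \<le> \<bar>c\<bar> / 2" "e \<le> \<epsilon> * \<bar>c\<bar> / 4"
    using \<open>\<epsilon> > 0\<close> assms(2) by (auto simp: e_def)
  have ev: "eventually (\<lambda>t. \<bar>F t - c\<bar> < e) at_top"
    using tendstoD[OF assms(1) e(1)] by (simp add: dist_real_def)
  have "eventually (\<lambda>t. \<forall>s. \<bar>s - t\<bar> \<le> (1/2) * t \<longrightarrow> \<bar>F s - F t\<bar> \<le> \<epsilon> * \<bar>F t\<bar>) at_top"
    using ev eventually_at_top_nearby[OF ev, of "1/2", simplified]
  proof eventually_elim
    case (elim t)
    show ?case
    proof (intro allI impI)
      fix s assume "\<bar>s - t\<bar> \<le> (1/2) * t"
      then have "\<bar>F s - c\<bar> < e" using elim(2) by auto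
      then have 1: "\<bar>F s - F t\<bar> \<le> 2 * e" using elim(1) by linarith
      have "\<bar>c\<bar> / 2 \<le> \<bar>F t\<bar>" using elim(1) e(2) by linarith
      then have "\<epsilon> * (\<bar>c\<bar> / 2) \<le> \<epsilon> * \<bar>F t\<bar>" using \<open>\<epsilon> > 0\<close> by (intro mult_left_mono) auto
      then show "\<bar>F s - F t\<bar> \<le> \<epsilon> * \<bar>F t\<bar>" using 1 e(3) by (simp add: field_simps)
    qed
  qed
  then show "\<exists>\<delta>>0. eventually (\<lambda>t. \<forall>s. \<bar>s - t\<bar> \<le> \<delta> * t \<longrightarrow> \<bar>F s - F t\<bar> \<le> \<epsilon> * \<bar>F t\<bar>) at_top"
    by (intro exI[of _ "1/2"]) auto
qed

lemma slowly_oscillating_inverse_ident: "slowly_oscillating (\<lambda>t. 1 / t)"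
  unfolding slowly_oscillating_def
proof (intro allI impI)
  fix \<epsilon> :: real assume "\<epsilon> > 0"
  define \<delta> where "\<delta> = min (1/2) (\<epsilon> / 2)"
  have \<delta>: "\<delta> > 0" "\<delta> \<le> 1/2" "\<delta> \<le> \<epsilon> / 2" using \<open>\<epsilon> > 0\<close> by (auto simp: \<delta>_def)
  have "\<bar>1 / s - 1 / t\<bar> \<le> \<epsilon> * \<bar>1 / t\<bar>" if "t > 0" "\<bar>s - t\<bar> \<le> \<delta> * t" for s t
  proof -
    have "\<delta> * t \<le> 1/2 * t" "\<delta> * t \<le> \<epsilon> / 2 * t" using \<delta> that by (auto intro!: mult_right_mono)
    then have s: "s \<ge> t / 2" "\<bar>s - t\<bar> \<le> \<epsilon> / 2 * t" using that by linarith+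
    then have "\<epsilon> * s \<ge> \<epsilon> * (t / 2)" using \<open>\<epsilon> > 0\<close> by (intro mult_left_mono) auto
    then have "\<bar>s - t\<bar> \<le> \<epsilon> * s" using s by simp
    moreover have "1 / s - 1 / t = (t - s) / (s * t)" using s that by (simp add: field_simps)
    ultimately show ?thesis using s that by (simp add: abs_mult abs_minus_commute field_simps)
  qed
  then show "\<exists>\<delta>>0. eventually (\<lambda>t. \<forall>s. \<bar>s - t\<bar> \<le> \<delta> * t \<longrightarrow> \<bar>1 / s - 1 / t\<bar> \<le> \<epsilon> * \<bar>1 / t\<bar>) at_top"
    using \<delta>(1) by (intro exI[of _ \<delta>] conjI eventually_mono[OF eventually_gt_at_top[of 0]]) blast+
qed

text \<open>
  In contrast to \<^const>\<open>regularly_varying\<close>, negative functions are allowed, and continuity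
  replaces measurability.
\<close>

definition rv :: "(real \<Rightarrow> real) \<Rightarrow> real \<Rightarrow> bool" where
  "rv F \<rho> \<longleftrightarrow> eventually_const_sign F \<and> eventually (isCont F) at_top \<and>
     (\<forall>x>0. ((\<lambda>t. F (x * t) / F t) \<longlongrightarrow> x powr \<rho>) at_top)"

lemma eventually_const_sign_uminus [simp]:
  "eventually_const_sign (\<lambda>t. - F t) \<longleftrightarrow> eventually_const_sign F"
  by (auto simp: eventually_const_sign_def)

lemma eventually_const_sign_nonzero:
  "eventually_const_sign F \<Longrightarrow> eventually (\<lambda>t. F t \<noteq> 0) at_top"
  unfolding eventually_const_sign_def by (auto elim!: eventually_mono)

lemma rv_uminus_iff [simp]: "rv (\<lambda>t. - F t) \<rho> \<longleftrightarrow> rv F \<rho>"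
proof -
  have "isCont (\<lambda>t. - F t) x = isCont F x" for x
    using isCont_minus[of x F] isCont_minus[of x "\<lambda>t. - F t"] by auto
  then show ?thesis by (simp add: rv_def)
qed

lemma eventually_const_sign_mult:
  assumes "eventually_const_sign F" "eventually_const_sign G"
  shows "eventually_const_sign (\<lambda>t. F t * G t)"
proof -
  from assms consider
    "eventually (\<lambda>t. F t > 0) at_top" "eventually (\<lambda>t. G t > 0) at_top"
  | "eventually (\<lambda>t. F t > 0) at_top" "eventually (\<lambda>t. G t < 0) at_top"
  | "eventually (\<lambda>t. F t < 0) at_top" "eventually (\<lambda>t. G t > 0) at_top"
  | "eventually (\<lambda>t. F t < 0) at_top" "eventually (\<lambda>t. G t < 0) at_top"
    unfolding eventually_const_sign_def by blast
  then show ?thesis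
  proof cases
    case 1
    then have "eventually (\<lambda>t. F t * G t > 0) at_top" by eventually_elim simp
    then show ?thesis by (simp add: eventually_const_sign_def)
  next
    case 2
    then have "eventually (\<lambda>t. F t * G t < 0) at_top" by eventually_elim (simp add: mult_pos_neg)
    then show ?thesis by (simp add: eventually_const_sign_def)
  next
    case 3
    then have "eventually (\<lambda>t. F t * G t < 0) at_top" by eventually_elim (simp add: mult_neg_pos)
    then show ?thesis by (simp add: eventually_const_sign_def)
  next
    case 4
    then have "eventually (\<lambda>t. F t * G t > 0) at_top" by eventually_elim (simp add: mult_neg_neg)
    then show ?thesis by (simp add: eventually_const_sign_def)
  qed
qed

lemma eventually_const_sign_tendsto:
  assumes "(F \<longlongrightarrow> c) at_top" "c \<noteq> 0"
  shows "eventually_const_sign F"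
  using assms order_tendstoD[OF assms(1)] unfolding eventually_const_sign_def
  by (cases "c > 0") auto

lemma eventually_const_sign_cong:
  assumes "eventually_const_sign F" "eventually (\<lambda>t. F t = G t) at_top"
  shows "eventually_const_sign G"
proof -
  have "eventually (\<lambda>t. P (G t)) at_top" if "eventually (\<lambda>t. P (F t)) at_top" for P
    using that assms(2) by eventually_elim simp
  from this[of "\<lambda>y. y > 0"] this[of "\<lambda>y. y < 0"] show ?thesis
    using assms(1) unfolding eventually_const_sign_def by blast
qed

text \<open>In the coordinate \<open>s = ln t\<close>, regular variation says that
  \<open>ln (F (exp s)) - \<rho> * s\<close> has increments tending to 0. The uniform convergence
  theorem bounds them for all short shifts at once, and the linear term changes little over a short
  shift.\<close>

lemma rv_slowly_oscillating_pos:
  assumes rv: "rv F \<rho>" and pos: "eventually (\<lambda>t. F t > 0) at_top"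
  shows "slowly_oscillating F"
proof -
  have "eventually (\<lambda>t. F t > 0 \<and> isCont F t) at_top"
    using pos rv unfolding rv_def by (auto intro: eventually_conj)
  then obtain a0 where a0: "\<And>t. t \<ge> a0 \<Longrightarrow> F t > 0 \<and> isCont F t"
    by (auto simp: eventually_at_top_linorder)
  define a where "a = max a0 1"
  have a: "a > 0" "\<And>t. t \<ge> a \<Longrightarrow> F t > 0" "\<And>t. t \<ge> a \<Longrightarrow> isCont F t"
    using a0 by (auto simp: a_def)
  define b where "b = ln a"
  have eb: "exp (max s b) \<ge> a" for s
  proof -
    have "exp b \<le> exp (max s b)" by simp
    then show ?thesis using a(1) by (simp add: b_def)
  qed
  \<comment> \<open>Freezing the argument below \<open>b\<close> makes \<open>g\<close> continuous
    on the whole line without changing it near infinity.\<close>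
  define g where "g = (\<lambda>s. ln (F (exp (max s b))) - \<rho> * max s b)"
  have cont: "continuous_on UNIV g"
  proof (intro continuous_at_imp_continuous_on ballI)
    fix s
    have "isCont (\<lambda>s. exp (max s b)) s" by (intro continuous_intros)
    then have "isCont (\<lambda>s. F (exp (max s b))) s" by (rule isCont_o2) (rule a(3)[OF eb])
    then show "isCont g s"
      unfolding g_def using a(2)[OF eb[of s]] by (intro continuous_intros) auto
  qed
  have lim: "((\<lambda>s. g (s + u) - g s) \<longlongrightarrow> 0) at_top" for u
  proof -
    have "((\<lambda>t. F (exp u * t) / F t) \<longlongrightarrow> exp u powr \<rho>) at_top"
      using rv unfolding rv_def by simp
    then have "((\<lambda>s. F (exp u * exp s) / F (exp s)) \<longlongrightarrow> exp u powr \<rho>) at_top"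
      by (rule filterlim_compose[OF _ exp_at_top])
    then have "((\<lambda>s. ln (F (exp u * exp s) / F (exp s)) - \<rho> * u) \<longlongrightarrow> ln (exp u powr \<rho>) - \<rho> * u) at_top"
      by (intro tendsto_intros) auto
    then have *: "((\<lambda>s. ln (F (exp u * exp s) / F (exp s)) - \<rho> * u) \<longlongrightarrow> 0) at_top"
      by (simp add: ln_powr)
    have "eventually (\<lambda>s. ln (F (exp u * exp s) / F (exp s)) - \<rho> * u = g (s + u) - g s) at_top"
      using eventually_ge_at_top[of b] eventually_ge_at_top[of "b - u"]
    proof eventually_elim
      case (elim s)
      then have "max s b = s" "max (s + u) b = s + u" by auto
      moreover from this have "F (exp s) > 0" "F (exp (s + u)) > 0"
        using a(2)[OF eb[of s]] a(2)[OF eb[of "s + u"]] by auto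
      ultimately show ?case by (simp add: g_def ln_div algebra_simps exp_add)
    qed
    with * show ?thesis by (rule Lim_transform_eventually)
  qed
  show ?thesis
    unfolding slowly_oscillating_def
  proof (intro allI impI)
    fix \<epsilon> :: real assume "\<epsilon> > 0"
    \<comment> \<open>Chosen so that \<open>exp (2 * e) \<le> 1 + \<epsilon>\<close> and
      \<open>1 - \<epsilon> \<le> exp (- (2 * e))\<close>; one \<open>e\<close> pays for
      \<open>g\<close>, the other for the linear term.\<close>
    define e where "e = min (ln (1 + \<epsilon>)) (\<epsilon> / (1 + \<epsilon>)) / 2"
    have e: "e > 0" "2 * e \<le> ln (1 + \<epsilon>)" "2 * e \<le> \<epsilon>"
    proof -
      have "\<epsilon> / (1 + \<epsilon>) \<le> \<epsilon>" using \<open>\<epsilon> > 0\<close> by (simp add: field_simps)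
      then show "e > 0" "2 * e \<le> ln (1 + \<epsilon>)" "2 * e \<le> \<epsilon>"
        using \<open>\<epsilon> > 0\<close> by (auto simp: e_def)
    qed
    obtain d where d: "d > 0" "eventually (\<lambda>s. \<forall>u. \<bar>u\<bar> \<le> d \<longrightarrow> \<bar>g (s + u) - g s\<bar> \<le> e) at_top"
      using uniform_convergence_additive[OF cont lim e(1)] by blast
    define d' where "d' = min d (e / (1 + \<bar>\<rho>\<bar>))"
    have d': "d' > 0" "d' \<le> d" "\<bar>\<rho>\<bar> * d' \<le> e"
    proof -
      have "\<bar>\<rho>\<bar> * d' \<le> (1 + \<bar>\<rho>\<bar>) * (e / (1 + \<bar>\<rho>\<bar>))"
        using e d by (intro mult_mono) (auto simp: d'_def)
      also have "\<dots> = e" by simp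
      finally show "\<bar>\<rho>\<bar> * d' \<le> e" .
    qed (use d e in \<open>auto simp: d'_def\<close>)
    \<comment> \<open>The cap 1/2 forces \<open>s \<ge> t / 2\<close>, whence
      \<open>\<bar>ln s - ln t\<bar> \<le> 2 * \<delta> \<le> d'\<close>.\<close>
    define \<delta> where "\<delta> = min (1/2) (d' / 2)"
    have \<delta>: "\<delta> > 0" "\<delta> \<le> 1/2" "2 * \<delta> \<le> d'" using d' by (auto simp: \<delta>_def)
    have "eventually (\<lambda>t. \<forall>u. \<bar>u\<bar> \<le> d \<longrightarrow> \<bar>g (ln t + u) - g (ln t)\<bar> \<le> e) at_top"
      by (rule eventually_compose_filterlim[OF d(2) ln_at_top])
    then have "eventually (\<lambda>t. \<forall>s. \<bar>s - t\<bar> \<le> \<delta> * t \<longrightarrow> \<bar>F s - F t\<bar> \<le> \<epsilon> * \<bar>F t\<bar>) at_top"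
      using eventually_ge_at_top[of "2 * a"]
    proof eventually_elim
      case (elim t)
      show ?case
      proof (intro allI impI)
        fix s assume s: "\<bar>s - t\<bar> \<le> \<delta> * t"
        have t: "t > 0" "t \<ge> a" using elim a(1) by auto
        have "\<delta> * t \<le> 1/2 * t" using \<delta> t by (intro mult_right_mono) auto
        then have sa: "s \<ge> a" "s \<ge> t / 2" using s elim(2) by linarith+
        have sp: "s > 0" using sa a(1) by linarith
        have u: "\<bar>ln s - ln t\<bar> \<le> d'"
        proof -
          have "\<bar>s - t\<bar> \<le> 2 * \<delta> * s"
          proof -
            have "\<delta> * (t / 2) \<le> \<delta> * s" using sa \<delta> by (intro mult_left_mono) auto
            then show ?thesis using s by simp
          qed
          moreover have "\<bar>s - t\<bar> \<le> 2 * \<delta> * t" using s \<delta> t by (smt (verit) mult_right_mono)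
          moreover have "ln s - ln t \<le> (s - t) / t"
            using ln_diff_le[of s t] sp t by simp
          moreover have "ln t - ln s \<le> (t - s) / s"
            using ln_diff_le[of t s] sp t by simp
          moreover have "(s - t) / t \<le> 2 * \<delta>" "(t - s) / s \<le> 2 * \<delta>"
            using calculation(1,2) sp t by (auto simp: pos_divide_le_eq)
          ultimately show ?thesis using \<delta>(3) by linarith
        qed
        have "\<bar>g (ln t + (ln s - ln t)) - g (ln t)\<bar> \<le> e"
          using elim(1) u d'(2) by (meson order_trans)
        then have "\<bar>g (ln s) - g (ln t)\<bar> \<le> e" by simp
        moreover have "max (ln s) b = ln s" "max (ln t) b = ln t"
          using sa t a(1) sp by (auto simp: b_def max_def)
        ultimately have "\<bar>ln (F s) - ln (F t) - \<rho> * (ln s - ln t)\<bar> \<le> e"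
          using sp t by (simp add: g_def algebra_simps)
        moreover have "\<bar>\<rho> * (ln s - ln t)\<bar> \<le> e"
          using u d'(3) mult_left_mono[OF u, of "\<bar>\<rho>\<bar>"] by (simp add: abs_mult)
        ultimately have l: "\<bar>ln (F s) - ln (F t)\<bar> \<le> 2 * e" by linarith
        have Fp: "F s > 0" "F t > 0" using a(2) sa t by auto
        have "ln (F s) \<le> ln (F t) + ln (1 + \<epsilon>)" using l e by linarith
        also have "\<dots> = ln (F t * (1 + \<epsilon>))" using Fp \<open>\<epsilon> > 0\<close> by (simp add: ln_mult)
        finally have up: "F s \<le> F t * (1 + \<epsilon>)" using Fp \<open>\<epsilon> > 0\<close> by (subst (asm) ln_le_cancel_iff) auto
        have "1 - \<epsilon> \<le> exp (- (2 * e))" using exp_ge_add_one_self[of "- (2 * e)"] e by linarith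
        also have "\<dots> \<le> exp (ln (F s) - ln (F t))" using l by simp
        also have "\<dots> = F s / F t" using Fp by (simp add: exp_diff)
        finally have "(1 - \<epsilon>) * F t \<le> F s" using Fp by (simp add: pos_le_divide_eq)
        then show "\<bar>F s - F t\<bar> \<le> \<epsilon> * \<bar>F t\<bar>" using up Fp by (simp add: algebra_simps)
      qed
    qed
    then show "\<exists>\<delta>>0. eventually (\<lambda>t. \<forall>s. \<bar>s - t\<bar> \<le> \<delta> * t \<longrightarrow> \<bar>F s - F t\<bar> \<le> \<epsilon> * \<bar>F t\<bar>) at_top"
      using \<delta>(1) by blast
  qed
qed

lemma slowly_oscillating_uminus [simp]:
  "slowly_oscillating (\<lambda>t. - F t) \<longleftrightarrow> slowly_oscillating F"
proof -
  have "\<bar>- F s - - F t\<bar> = \<bar>F s - F t\<bar>" for s t by simp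
  then show ?thesis by (simp add: slowly_oscillating_def)
qed

lemma rv_slowly_oscillating:
  assumes "rv F \<rho>"
  shows "slowly_oscillating F"
proof (cases "eventually (\<lambda>t. F t > 0) at_top")
  case True
  then show ?thesis using assms rv_slowly_oscillating_pos by blast
next
  case False
  then have "eventually (\<lambda>t. - F t > 0) at_top"
    using assms by (auto simp: rv_def eventually_const_sign_def)
  then show ?thesis using rv_slowly_oscillating_pos[of "\<lambda>t. - F t" \<rho>] assms by simp
qed

subsection \<open>Karamata's theorem in differential form\<close>

lemma eventually_has_real_derivative_cong:
  assumes "eventually (\<lambda>t. (F has_real_derivative F' t) (at t)) at_top"
    and "eventually (\<lambda>t. F t = G t) at_top" "eventually (\<lambda>t. F' t = G' t) at_top"
  shows "eventually (\<lambda>t. (G has_real_derivative G' t) (at t)) at_top"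
proof -
  obtain T where T: "\<And>t. t \<ge> T \<Longrightarrow> F t = G t"
    using assms(2) by (auto simp: eventually_at_top_linorder)
  show ?thesis using assms(1,3) eventually_gt_at_top[of T]
  proof eventually_elim
    case (elim t)
    have "(G has_real_derivative F' t) (at t)"
      by (rule DERIV_cong_ev[THEN iffD1, OF refl _ refl elim(1)])
         (use elim(3) T in \<open>auto intro!: eventually_mono[OF eventually_nhds_in_open[of "{T<..}"]]\<close>)
    then show ?case using elim(2) by simp
  qed
qed

lemma filterlim_mult_at_top: "x > 0 \<Longrightarrow> filterlim (\<lambda>t. x * t) at_top (at_top :: real filter)"
  by (rule filterlim_tendsto_pos_mult_at_top[OF tendsto_const _ filterlim_ident])

lemma eventually_scaled_at_top:
  fixes P :: "real \<Rightarrow> bool"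
  shows "eventually P at_top \<Longrightarrow> x > 0 \<Longrightarrow> eventually (\<lambda>t. P (x * t)) at_top"
  by (rule eventually_compose_filterlim[OF _ filterlim_mult_at_top])

text \<open>Substituting \<open>inverse x\<close> turns the limit at infinity into one at 0 from the
  right; the chain rule factors cancel in the quotient of the derivatives.\<close>

lemma lhopital_at_top_zero:
  fixes f g :: "real \<Rightarrow> real"
  assumes f0: "(f \<longlongrightarrow> 0) at_top" and g0: "(g \<longlongrightarrow> 0) at_top"
    and g: "eventually (\<lambda>x. g x \<noteq> 0) at_top"
    and g': "eventually (\<lambda>x. g' x \<noteq> 0) at_top"
    and Df: "eventually (\<lambda>x. DERIV f x :> f' x) at_top"
    and Dg: "eventually (\<lambda>x. DERIV g x :> g' x) at_top"
    and lim: "((\<lambda>x. f' x / g' x) \<longlongrightarrow> l) at_top"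
  shows "((\<lambda>x. f x / g x) \<longlongrightarrow> l) at_top"
  unfolding filterlim_at_top_to_right
proof (rule lhopital_right_0)
  let ?D = "\<lambda>f' x. f' (inverse x) * - (inverse x ^ Suc (Suc 0))"
  show "((\<lambda>x. f (inverse x)) \<longlongrightarrow> 0) (at_right 0)" "((\<lambda>x. g (inverse x)) \<longlongrightarrow> 0) (at_right 0)"
    using f0 g0 unfolding filterlim_at_top_to_right .
  show "eventually (\<lambda>x. g (inverse x) \<noteq> 0) (at_right 0)"
    using g unfolding eventually_at_right_to_top by simp
  show "eventually (\<lambda>x. DERIV (\<lambda>x. g (inverse x)) x :> ?D g' x) (at_right 0)"
    unfolding eventually_at_right_to_top
    using Dg eventually_ge_at_top[where c=1]
    by eventually_elim (rule derivative_eq_intros DERIV_chain'[where f=inverse] | simp)+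
  show "eventually (\<lambda>x. DERIV (\<lambda>x. f (inverse x)) x :> ?D f' x) (at_right 0)"
    unfolding eventually_at_right_to_top
    using Df eventually_ge_at_top[where c=1]
    by eventually_elim (rule derivative_eq_intros DERIV_chain'[where f=inverse] | simp)+
  show "eventually (\<lambda>x. ?D g' x \<noteq> 0) (at_right 0)"
    unfolding eventually_at_right_to_top
    using g' eventually_ge_at_top[where c=1]
    by eventually_elim auto
  show "((\<lambda>x. ?D f' x / ?D g' x) \<longlongrightarrow> l) (at_right 0)"
    unfolding filterlim_at_right_to_top
    apply (intro filterlim_cong[THEN iffD2, OF refl refl _ lim])
    using eventually_ge_at_top[where c=1]
    by eventually_elim simp
qed

text \<open>L'Hospital's rule against the identity. For \<open>q\<close> it turns
  \<open>Dq \<rightarrow> 0\<close> into \<open>q t = o(t)\<close>.\<close>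

lemma tendsto_ratio_zero_of_deriv:
  fixes F :: "real \<Rightarrow> real"
  assumes "eventually (\<lambda>t. (F has_real_derivative G t) (at t)) at_top" "(G \<longlongrightarrow> 0) at_top"
  shows "((\<lambda>t. F t / t) \<longlongrightarrow> 0) at_top"
  by (rule lhospital_at_top_at_top[where g' = "\<lambda>_. 1", OF filterlim_ident _ assms(1)]) (use assms(2) in auto)

lemma strict_mono_eventually:
  assumes "eventually (\<lambda>t. (F has_real_derivative G t) (at t)) at_top" "eventually (\<lambda>t. G t > 0) at_top"
  obtains T where "\<And>s t. T \<le> s \<Longrightarrow> s < t \<Longrightarrow> F s < F t"
proof -
  obtain T where T: "\<And>t. t \<ge> T \<Longrightarrow> (F has_real_derivative G t) (at t) \<and> G t > 0"
    using eventually_conj[OF assms] by (auto simp: eventually_at_top_linorder)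
  have "F s < F t" if "T \<le> s" "s < t" for s t
  proof (rule DERIV_pos_imp_increasing[OF that(2)])
    fix x assume "s \<le> x" "x \<le> t"
    then show "\<exists>y. (F has_real_derivative y) (at x) \<and> y > 0"
      using T[of x] that(1) by (intro exI[of _ "G x"]) simp
  qed
  then show ?thesis using that by blast
qed

lemma increasing_tendsto_zero_neg:
  fixes F :: "real \<Rightarrow> real"
  assumes "\<And>s t. T \<le> s \<Longrightarrow> s < t \<Longrightarrow> F s < F t" "(F \<longlongrightarrow> 0) at_top" "t \<ge> T"
  shows "F t < 0"
proof -
  have "F t < F (t + 1)" using assms(1,3) by simp
  moreover have "F (t + 1) \<le> 0"
  proof (rule tendsto_lowerbound[OF assms(2)])
    show "eventually (\<lambda>s. F (t + 1) \<le> F s) at_top"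
      using eventually_gt_at_top[of "t + 1"]
      by eventually_elim (use assms(1,3) in \<open>simp add: less_imp_le\<close>)
  qed simp
  ultimately show ?thesis by simp
qed

text \<open>By l'Hospital's rule \<open>F (x * t) / F t\<close> has the limit of
  \<open>x * G (x * t) / G t\<close>, which gives the index \<open>\<rho> + 1\<close>. For the
  second claim, the difference quotient of \<open>F\<close> over the step from \<open>t\<close> to
  \<open>(1 + h) * t\<close> is close to \<open>\<rho> + 1\<close> after division by
  \<open>F t / t\<close>; the mean value theorem turns it into a value of \<open>G\<close>, and slow
  oscillation of \<open>G\<close> moves that value to \<open>t\<close>.\<close>

lemma karamata_pos:
  assumes der: "eventually (\<lambda>t. (F has_real_derivative G t) (at t)) at_top"
    and rvG: "rv G \<rho>" and Gpos: "eventually (\<lambda>t. G t > 0) at_top"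
    and lim: "(F \<longlongrightarrow> 0) at_top \<or> filterlim F at_top at_top"
  shows "rv F (\<rho> + 1) \<and> ((\<lambda>t. t * G t / F t) \<longlongrightarrow> \<rho> + 1) at_top"
proof -
  obtain T where T: "\<And>s t. T \<le> s \<Longrightarrow> s < t \<Longrightarrow> F s < F t"
    using strict_mono_eventually[OF der Gpos] by blast
  \<comment> \<open>\<open>F\<close> is eventually strictly increasing, so it either approaches 0
    from below or becomes positive.\<close>
  have sign: "eventually_const_sign F"
  proof (cases "(F \<longlongrightarrow> 0) at_top")
    case True
    then have "eventually (\<lambda>t. F t < 0) at_top"
      by (intro eventually_mono[OF eventually_ge_at_top[of T]] increasing_tendsto_zero_neg[OF T])
    then show ?thesis by (simp add: eventually_const_sign_def)
  next
    case False
    then have "filterlim F at_top at_top" using lim by simp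
    then show ?thesis unfolding eventually_const_sign_def filterlim_at_top_dense by blast
  qed
  have Fnz: "eventually (\<lambda>t. F t \<noteq> 0) at_top" by (rule eventually_const_sign_nonzero[OF sign])
  have Gnz: "eventually (\<lambda>t. G t \<noteq> 0) at_top" using Gpos by eventually_elim simp
  have ratio: "((\<lambda>t. F (x * t) / F t) \<longlongrightarrow> x powr (\<rho> + 1)) at_top" if "x > 0" for x
  proof -
    have Dx: "eventually (\<lambda>t. ((\<lambda>t. F (x * t)) has_real_derivative x * G (x * t)) (at t)) at_top"
      using eventually_scaled_at_top[OF der that]
    proof eventually_elim
      case (elim t)
      show ?case
        using DERIV_chain2[where f = F and g = "\<lambda>t. x * t", OF elim DERIV_cmult_Id]
        by (simp add: mult.commute)
    qed
    have "((\<lambda>t. G (x * t) / G t) \<longlongrightarrow> x powr \<rho>) at_top" using rvG that by (simp add: rv_def)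
    then have "((\<lambda>t. x * (G (x * t) / G t)) \<longlongrightarrow> x * x powr \<rho>) at_top" by (intro tendsto_intros)
    moreover have "x * x powr \<rho> = x powr (\<rho> + 1)" using that by (simp add: powr_add)
    ultimately have l: "((\<lambda>t. x * G (x * t) / G t) \<longlongrightarrow> x powr (\<rho> + 1)) at_top" by simp
    show ?thesis
    proof (cases "(F \<longlongrightarrow> 0) at_top")
      case True
      have "((\<lambda>t. F (x * t)) \<longlongrightarrow> 0) at_top"
        by (rule filterlim_compose[OF True filterlim_mult_at_top[OF that]])
      then show ?thesis by (rule lhopital_at_top_zero[OF _ True Fnz Gnz Dx der l])
    next
      case False
      then show ?thesis using lim lhospital_at_top_at_top[OF _ Gnz Dx der l] by blast
    qed
  qed
  have cont: "eventually (isCont F) at_top" using der by eventually_elim (rule DERIV_isCont)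
  have rvF: "rv F (\<rho> + 1)" using sign cont ratio by (simp add: rv_def)
  have "((\<lambda>t. t * G t / F t) \<longlongrightarrow> \<rho> + 1) at_top"
  proof (rule tendstoI)
    fix \<epsilon> :: real assume "\<epsilon> > 0"
    \<comment> \<open>\<open>M\<close> exceeds \<open>\<bar>w\<bar>\<close> for the quotient
      \<open>w\<close> below; as \<open>\<bar>w - v\<bar>\<close> is at most half of
      \<open>\<bar>v\<bar>\<close>, this gives \<open>\<bar>v\<bar> \<le> 2 * M\<close>, and
      \<open>e\<close> makes \<open>e * \<bar>v\<bar>\<close> at most
      \<open>\<epsilon> / 2\<close>.\<close>
    define M where "M = \<bar>\<rho> + 1\<bar> + \<epsilon> + 1"
    have M: "M > 0" using \<open>\<epsilon> > 0\<close> by (simp add: M_def)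
    define e where "e = min (1/2) (\<epsilon> / (4 * M))"
    have e: "e > 0" "e \<le> 1/2" "e * (4 * M) \<le> \<epsilon>"
    proof -
      have "e * (4 * M) \<le> \<epsilon> / (4 * M) * (4 * M)" using M by (intro mult_right_mono) (auto simp: e_def)
      then show "e > 0" "e \<le> 1/2" "e * (4 * M) \<le> \<epsilon>" using M \<open>\<epsilon> > 0\<close> by (auto simp: e_def)
    qed
    obtain T' where T': "\<And>t. t \<ge> T' \<Longrightarrow> (F has_real_derivative G t) (at t)"
      using der by (auto simp: eventually_at_top_linorder)
    obtain \<delta> where \<delta>: "\<delta> > 0"
      "eventually (\<lambda>t. \<forall>s. \<bar>s - t\<bar> \<le> \<delta> * t \<longrightarrow> \<bar>G s - G t\<bar> \<le> e * \<bar>G t\<bar>) at_top"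
      using rv_slowly_oscillating[OF rvG, unfolded slowly_oscillating_def, rule_format, OF e(1)] by blast
    \<comment> \<open>The derivative of \<open>x powr (\<rho> + 1)\<close> at 1 is
      \<open>\<rho> + 1\<close>. A fixed step \<open>h\<close> is taken with difference quotient
      within \<open>\<epsilon> / 4\<close> of it, and below \<delta> so that the mean value point
      stays in the window of slow oscillation.\<close>
    have "((\<lambda>h. ((1 + h) powr (\<rho> + 1) - 1 powr (\<rho> + 1)) / h) \<longlongrightarrow> \<rho> + 1) (at 0)"
    proof -
      have "((\<lambda>x. x powr (\<rho> + 1)) has_real_derivative (\<rho> + 1) * 1 powr (\<rho> + 1 - 1)) (at 1)"
        by (rule has_real_derivative_powr) simp
      then show ?thesis by (simp add: DERIV_def)
    qed
    then have l: "((\<lambda>h. ((1 + h) powr (\<rho> + 1) - 1 powr (\<rho> + 1)) / h) \<longlongrightarrow> \<rho> + 1) (at_right 0)"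
      by (simp only: filterlim_at_split)
    have "eventually (\<lambda>h. dist (((1 + h) powr (\<rho> + 1) - 1 powr (\<rho> + 1)) / h) (\<rho> + 1) < \<epsilon> / 4) (at_right 0)"
      by (rule tendstoD[OF l]) (use \<open>\<epsilon> > 0\<close> in simp)
    moreover have "eventually (\<lambda>h. h < \<delta>) (at_right 0)"
      using \<delta>(1) by (auto simp: eventually_at_right[of 0 1])
    ultimately have "eventually (\<lambda>h. \<bar>((1 + h) powr (\<rho> + 1) - 1) / h - (\<rho> + 1)\<bar> < \<epsilon> / 4 \<and> h < \<delta> \<and> h > 0) (at_right 0)"
      using eventually_at_right_less[of 0] by eventually_elim (simp add: dist_real_def)
    from eventually_happens'[OF trivial_limit_at_right_real this]
    obtain h where h: "\<bar>((1 + h) powr (\<rho> + 1) - 1) / h - (\<rho> + 1)\<bar> < \<epsilon> / 4" "h < \<delta>" "h > 0"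
      by blast
    define c where "c = ((1 + h) powr (\<rho> + 1) - 1) / h"
    have "((\<lambda>t. (F ((1 + h) * t) / F t - 1) / h) \<longlongrightarrow> c) at_top"
      unfolding c_def using h by (intro tendsto_intros ratio) auto
    from tendstoD[OF this, of "\<epsilon> / 4"]
    have "eventually (\<lambda>t. \<bar>(F ((1 + h) * t) / F t - 1) / h - c\<bar> < \<epsilon> / 4) at_top"
      using \<open>\<epsilon> > 0\<close> by (simp add: dist_real_def)
    then show "eventually (\<lambda>t. dist (t * G t / F t) (\<rho> + 1) < \<epsilon>) at_top"
      using \<delta>(2) Fnz Gpos eventually_gt_at_top[of 0] eventually_ge_at_top[of T']
    proof eventually_elim
      case (elim t)
      have "t < (1 + h) * t" using elim h by simp
      then obtain \<xi> where \<xi>: "t < \<xi>" "\<xi> < (1 + h) * t" "F ((1 + h) * t) - F t = ((1 + h) * t - t) * G \<xi>"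
        using MVT2[of t "(1 + h) * t" F G] T' elim(6) by auto
      have "h * t \<le> \<delta> * t" using h elim by simp
      then have "\<bar>\<xi> - t\<bar> \<le> \<delta> * t" using \<xi> by (simp add: algebra_simps)
      then have G: "\<bar>G \<xi> - G t\<bar> \<le> e * G t" using elim by auto
      \<comment> \<open>\<open>w\<close> differs from the target \<open>v\<close> only in the
        argument of \<open>G\<close>, and it is the relative difference quotient of \<open>F\<close>
        at step \<open>h\<close>.\<close>
      define v where "v = t * G t / F t"
      define w where "w = t * G \<xi> / F t"
      have "(F ((1 + h) * t) / F t - 1) / h = (F ((1 + h) * t) - F t) / F t / h"
        using elim by (simp add: diff_divide_distrib)
      also have "F ((1 + h) * t) - F t = h * (t * G \<xi>)" using \<xi>(3) by (simp add: algebra_simps)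
      also have "\<dots> / F t / h = w" using h(3) by (simp add: w_def)
      finally have w: "\<bar>w - (\<rho> + 1)\<bar> < \<epsilon> / 2" using elim(1) h(1) unfolding c_def by linarith
      have "w - v = t / F t * (G \<xi> - G t)" by (simp add: w_def v_def algebra_simps)
      then have "\<bar>w - v\<bar> = \<bar>t / F t\<bar> * \<bar>G \<xi> - G t\<bar>" by (simp add: abs_mult)
      also have "\<dots> \<le> \<bar>t / F t\<bar> * (e * G t)" using G by (intro mult_left_mono) auto
      also have "\<dots> = e * \<bar>v\<bar>" using elim by (simp add: v_def abs_mult)
      finally have wv: "\<bar>w - v\<bar> \<le> e * \<bar>v\<bar>" .
      also have "\<dots> \<le> 1/2 * \<bar>v\<bar>" using e by (intro mult_right_mono) auto
      finally have "\<bar>w - v\<bar> \<le> 1/2 * \<bar>v\<bar>" .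
      moreover have "\<bar>v\<bar> \<le> \<bar>w\<bar> + \<bar>w - v\<bar>" "\<bar>w\<bar> \<le> \<bar>w - (\<rho> + 1)\<bar> + \<bar>\<rho> + 1\<bar>" by arith+
      ultimately have "\<bar>v\<bar> \<le> 2 * M" using w \<open>\<epsilon> > 0\<close> unfolding M_def by argo
      then have "e * \<bar>v\<bar> \<le> e * (2 * M)" using e by (intro mult_left_mono) auto
      then have "\<bar>w - v\<bar> \<le> \<epsilon> / 2" using wv e by linarith
      then have "\<bar>v - (\<rho> + 1)\<bar> < \<epsilon>" using w by linarith
      then show ?case by (simp add: v_def dist_real_def)
    qed
  qed
  with rvF show ?thesis by blast
qed

lemma karamata:
  assumes der: "eventually (\<lambda>t. (F has_real_derivative G t) (at t)) at_top"
    and rvG: "rv G \<rho>"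
    and lim: "(F \<longlongrightarrow> 0) at_top \<or> filterlim F at_top at_top"
  shows "rv F (\<rho> + 1)" "((\<lambda>t. t * G t / F t) \<longlongrightarrow> \<rho> + 1) at_top"
proof -
  have "rv F (\<rho> + 1) \<and> ((\<lambda>t. t * G t / F t) \<longlongrightarrow> \<rho> + 1) at_top"
  proof (cases "eventually (\<lambda>t. G t > 0) at_top")
    case True
    then show ?thesis using karamata_pos[OF der rvG True lim] by simp
  next
    case False
    then have neg: "eventually (\<lambda>t. - G t > 0) at_top"
      using rvG by (auto simp: rv_def eventually_const_sign_def)
    have der': "eventually (\<lambda>t. ((\<lambda>t. - F t) has_real_derivative - G t) (at t)) at_top"
      using der by eventually_elim (rule DERIV_minus)
    obtain T where T: "\<And>s t. T \<le> s \<Longrightarrow> s < t \<Longrightarrow> - F s < - F t"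
      using strict_mono_eventually[OF der' neg] by blast
    \<comment> \<open>\<open>F\<close> is eventually decreasing, which leaves only the limit 0; that
      case is symmetric under a change of sign.\<close>
    have "\<not> filterlim F at_top at_top"
    proof
      assume "filterlim F at_top at_top"
      then have "eventually (\<lambda>t. F t > F T \<and> t > T) at_top"
        by (intro eventually_conj eventually_gt_at_top) (auto simp: filterlim_at_top_dense)
      from eventually_happens'[OF trivial_limit_at_top_linorder this]
      obtain t where "F t > F T" "t > T" by blast
      with T[of T t] show False by simp
    qed
    then have "((\<lambda>t. - F t) \<longlongrightarrow> 0) at_top" using lim tendsto_minus[of F 0 at_top] by simp
    then show ?thesis using karamata_pos[OF der' _ neg, of \<rho>] rvG by simp
  qed
  then show "rv F (\<rho> + 1)" "((\<lambda>t. t * G t / F t) \<longlongrightarrow> \<rho> + 1) at_top" by auto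
qed

subsection \<open>Asymptotically constant functions\<close>

text \<open>
  With \<open>\<theta> u = t u'\<close>, the predicate \<open>asymp_const k u c\<close> says that \<open>u \<rightarrow> c\<close> and
  \<open>\<theta> u, \<dots>, \<theta>\<^sup>k u \<rightarrow> 0\<close>.
\<close>

primrec asymp_const :: "nat \<Rightarrow> (real \<Rightarrow> real) \<Rightarrow> real \<Rightarrow> bool" where
  "asymp_const 0 u c \<longleftrightarrow> (u \<longlongrightarrow> c) at_top"
| "asymp_const (Suc k) u c \<longleftrightarrow> (u \<longlongrightarrow> c) at_top \<and>
     (\<exists>w. asymp_const k w 0 \<and> eventually (\<lambda>t. (u has_real_derivative w t / t) (at t)) at_top)"

lemma asymp_const_tendsto: "asymp_const k u c \<Longrightarrow> (u \<longlongrightarrow> c) at_top"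
  by (cases k) auto

lemma asymp_const_SucD: "asymp_const (Suc k) u c \<Longrightarrow> asymp_const k u c"
proof (induction k arbitrary: u c)
  case (Suc k)
  then obtain w where "asymp_const (Suc k) w 0"
    "eventually (\<lambda>t. (u has_real_derivative w t / t) (at t)) at_top" by auto
  then show ?case using Suc asymp_const_tendsto[OF Suc.prems] by auto
qed simp

lemma asymp_const_const: "asymp_const k (\<lambda>_. c) c"
proof (induction k arbitrary: c)
  case (Suc k)
  then show ?case by (auto intro!: exI[of _ "\<lambda>_. 0"])
qed simp

lemma asymp_const_add:
  "asymp_const k u b \<Longrightarrow> asymp_const k v c \<Longrightarrow> asymp_const k (\<lambda>t. u t + v t) (b + c)"
proof (induction k arbitrary: u v b c)
  case (Suc k)
  from Suc.prems obtain w z where wz: "asymp_const k w 0" "asymp_const k z 0"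
    and u: "eventually (\<lambda>t. (u has_real_derivative w t / t) (at t)) at_top"
    and v: "eventually (\<lambda>t. (v has_real_derivative z t / t) (at t)) at_top" by auto
  have "eventually (\<lambda>t. ((\<lambda>t. u t + v t) has_real_derivative (w t + z t) / t) (at t)) at_top"
    using u v by eventually_elim (auto intro!: derivative_eq_intros simp: add_divide_distrib)
  moreover have "asymp_const k (\<lambda>t. w t + z t) 0" using Suc.IH[OF wz] by simp
  moreover have "((\<lambda>t. u t + v t) \<longlongrightarrow> b + c) at_top"
    using Suc.prems[THEN asymp_const_tendsto] by (rule tendsto_add)
  ultimately show ?case by auto
qed (auto intro: tendsto_add)

text \<open>\<theta> obeys the product rule
  \<open>\<theta> (u v) = (\<theta> u) v + u (\<theta> v)\<close>, and each summand has a factor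
  that is asymptotically 0; the other factor is used at one order less.\<close>

lemma asymp_const_mult:
  "asymp_const k u b \<Longrightarrow> asymp_const k v c \<Longrightarrow> asymp_const k (\<lambda>t. u t * v t) (b * c)"
proof (induction k arbitrary: u v b c)
  case (Suc k)
  from Suc.prems obtain w z where wz: "asymp_const k w 0" "asymp_const k z 0"
    and u: "eventually (\<lambda>t. (u has_real_derivative w t / t) (at t)) at_top"
    and v: "eventually (\<lambda>t. (v has_real_derivative z t / t) (at t)) at_top" by auto
  have "eventually (\<lambda>t. ((\<lambda>t. u t * v t) has_real_derivative (w t * v t + u t * z t) / t) (at t)) at_top"
    using u v by eventually_elim (auto intro!: derivative_eq_intros simp: add_divide_distrib)
  moreover have "asymp_const k (\<lambda>t. w t * v t + u t * z t) 0"
    using asymp_const_add[OF Suc.IH[OF wz(1) asymp_const_SucD[OF Suc.prems(2)]]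
        Suc.IH[OF asymp_const_SucD[OF Suc.prems(1)] wz(2)]] by simp
  moreover have "((\<lambda>t. u t * v t) \<longlongrightarrow> b * c) at_top"
    using Suc.prems[THEN asymp_const_tendsto] by (rule tendsto_mult)
  ultimately show ?case by auto
qed (auto intro: tendsto_mult)

lemma asymp_const_diff:
  assumes "asymp_const k u b" "asymp_const k v c"
  shows "asymp_const k (\<lambda>t. u t - v t) (b - c)"
  using asymp_const_add[OF assms(1) asymp_const_mult[OF asymp_const_const[of k "-1"] assms(2)]] by simp

text \<open>Here \<open>\<theta> (1 / u) = - \<theta> u / u^2\<close>, where
  \<open>\<theta> u\<close> is asymptotically 0 and the induction hypothesis covers
  \<open>1 / u\<close> at one order less.\<close>

lemma asymp_const_inverse:
  "asymp_const k u c \<Longrightarrow> c \<noteq> 0 \<Longrightarrow> asymp_const k (\<lambda>t. inverse (u t)) (inverse c)"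
proof (induction k arbitrary: u c)
  case (Suc k)
  from Suc.prems obtain w where w: "asymp_const k w 0"
    and u: "eventually (\<lambda>t. (u has_real_derivative w t / t) (at t)) at_top" by auto
  have lim: "(u \<longlongrightarrow> c) at_top" using Suc.prems by simp
  have "eventually (\<lambda>t. u t \<noteq> 0) at_top" using tendsto_imp_eventually_ne[OF lim Suc.prems(2)] .
  with u have "eventually (\<lambda>t. ((\<lambda>t. inverse (u t)) has_real_derivative
      (-1) * w t * (inverse (u t) * inverse (u t)) / t) (at t)) at_top"
    by eventually_elim (auto intro!: derivative_eq_intros)
  moreover have inv: "asymp_const k (\<lambda>t. inverse (u t)) (inverse c)"
    using Suc.IH asymp_const_SucD Suc.prems by blast
  have "asymp_const k (\<lambda>t. (-1) * w t * (inverse (u t) * inverse (u t))) 0"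
    using asymp_const_mult[OF asymp_const_mult[OF asymp_const_const[of k "-1"] w] asymp_const_mult[OF inv inv]]
    by simp
  moreover have "((\<lambda>t. inverse (u t)) \<longlongrightarrow> inverse c) at_top"
    using lim Suc.prems(2) by (rule tendsto_inverse)
  ultimately show ?case by auto
qed (auto intro: tendsto_inverse)

subsection \<open>Logarithmic derivatives of the successive derivatives\<close>

text \<open>The sign of \<open>G\<close> makes \<open>F\<close> eventually monotone. If increasing,
  it converges to its supremum on a ray or is unbounded; the decreasing case follows by
  negation.\<close>

lemma monotone_limit_cases:
  fixes F :: "real \<Rightarrow> real"
  assumes "eventually (\<lambda>t. (F has_real_derivative G t) (at t)) at_top" "eventually_const_sign G"
  shows "(\<exists>c. (F \<longlongrightarrow> c) at_top) \<or> filterlim F at_top at_top \<or> filterlim F at_bot at_top"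
proof -
  have inc: "(\<exists>c. (F \<longlongrightarrow> c) at_top) \<or> filterlim F at_top at_top"
    if der: "eventually (\<lambda>t. (F has_real_derivative G t) (at t)) at_top"
      and pos: "eventually (\<lambda>t. G t > 0) at_top" for F G :: "real \<Rightarrow> real"
  proof -
    obtain T where T: "\<And>s t. T \<le> s \<Longrightarrow> s < t \<Longrightarrow> F s < F t"
      using strict_mono_eventually[OF der pos] by blast
    have mono: "F s \<le> F t" if "T \<le> s" "s \<le> t" for s t
      using T[of s t] that by (cases "s = t") auto
    show ?thesis
    proof (cases "bdd_above (F ` {T..})")
      case True
      have "(F \<longlongrightarrow> Sup (F ` {T..})) at_top"
      proof (rule increasing_tendsto)
        show "eventually (\<lambda>t. F t \<le> Sup (F ` {T..})) at_top"
          using eventually_ge_at_top[of T] by eventually_elim (auto intro!: cSup_upper True)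
      next
        fix x assume "x < Sup (F ` {T..})"
        then obtain s where s: "s \<ge> T" "x < F s"
          using less_cSup_iff[of "F ` {T..}" x] True by auto
        show "eventually (\<lambda>t. x < F t) at_top"
          using eventually_ge_at_top[of s] by eventually_elim (use s mono less_le_trans in blast)
      qed
      then show ?thesis by blast
    next
      case False
      have "filterlim F at_top at_top"
        unfolding filterlim_at_top
      proof
        fix Z
        obtain s where s: "s \<ge> T" "Z \<le> F s"
          using False unfolding bdd_above_def by (auto simp: not_le intro: less_imp_le)
        show "eventually (\<lambda>t. Z \<le> F t) at_top"
          using eventually_ge_at_top[of s] by eventually_elim (use s mono order_trans in blast)
      qed
      then show ?thesis by blast
    qed
  qed
  show ?thesis
  proof (cases "eventually (\<lambda>t. G t > 0) at_top")
    case True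
    then show ?thesis using inc assms(1) by blast
  next
    case False
    then have "eventually (\<lambda>t. - G t > 0) at_top"
      using assms(2) by (auto simp: eventually_const_sign_def)
    moreover have "eventually (\<lambda>t. ((\<lambda>t. - F t) has_real_derivative - G t) (at t)) at_top"
      using assms(1) by eventually_elim (rule DERIV_minus)
    ultimately have "(\<exists>c. ((\<lambda>t. - F t) \<longlongrightarrow> c) at_top) \<or> filterlim (\<lambda>t. - F t) at_top at_top"
      by (intro inc)
    then show ?thesis
    proof (elim disjE exE)
      fix c assume "((\<lambda>t. - F t) \<longlongrightarrow> c) at_top"
      from tendsto_minus[OF this] show ?thesis by auto
    next
      assume "filterlim (\<lambda>t. - F t) at_top at_top"
      then show ?thesis by (simp add: filterlim_uminus_at_top)
    qed
  qed
qed

lemma filterlim_at_top_deriv_ge: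
  assumes "eventually (\<lambda>t. (F has_real_derivative G t) (at t)) at_top"
    and "eventually (\<lambda>t. G t \<ge> c) at_top" "c > 0"
  shows "filterlim F at_top at_top"
proof -
  obtain T where T: "\<And>t. t \<ge> T \<Longrightarrow> (F has_real_derivative G t) (at t) \<and> G t \<ge> c"
    using eventually_conj[OF assms(1,2)] by (auto simp: eventually_at_top_linorder)
  have "filterlim (\<lambda>t. (F T - c * T) + c * t) at_top at_top"
    by (intro filterlim_tendsto_add_at_top[OF tendsto_const] filterlim_mult_at_top assms)
  moreover have "eventually (\<lambda>t. (F T - c * T) + c * t \<le> F t) at_top"
    using eventually_gt_at_top[of T]
  proof eventually_elim
    case (elim t)
    obtain \<xi> where \<xi>: "T < \<xi>" "F t - F T = (t - T) * G \<xi>"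
      using MVT2[of T t F G] T elim by auto
    have "(t - T) * c \<le> (t - T) * G \<xi>" using T[of \<xi>] \<xi>(1) elim by (intro mult_left_mono) auto
    then show ?case using \<xi>(2) by (simp add: algebra_simps)
  qed
  ultimately show ?thesis by (rule filterlim_at_top_mono)
qed

text \<open>Integrating a bound \<open>d k \<ge> c > 0\<close> drives \<open>d (k - 1)\<close> to
  infinity, and in turn every lower derivative down to \<open>d 1\<close>, against
  \<open>d 1 \<rightarrow> 0\<close>.\<close>

lemma higher_derivative_not_bounded_away:
  fixes d :: "nat \<Rightarrow> real \<Rightarrow> real"
  assumes der: "\<And>k. k < N \<Longrightarrow> eventually (\<lambda>t. (d k has_real_derivative d (Suc k) t) (at t)) at_top"
    and d1: "(d 1 \<longlongrightarrow> 0) at_top" and "1 \<le> k" "k \<le> N" "c > 0"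
  shows "\<not> eventually (\<lambda>t. d k t \<ge> c) at_top"
  using assms(3-)
proof (induction k arbitrary: c)
  case (Suc k)
  show ?case
  proof
    assume *: "eventually (\<lambda>t. d (Suc k) t \<ge> c) at_top"
    show False
    proof (cases "k = 0")
      case True
      then have "eventually (\<lambda>t. d (Suc k) t < c) at_top"
        using order_tendstoD(2)[OF d1 Suc.prems(3)] by simp
      with * have "eventually (\<lambda>t::real. False) at_top" by eventually_elim simp
      then show False by simp
    next
      case False
      have "filterlim (d k) at_top at_top"
        using filterlim_at_top_deriv_ge[OF der * Suc.prems(3)] Suc.prems by simp
      then have "eventually (\<lambda>t. d k t \<ge> 1) at_top" by (simp add: filterlim_at_top)
      then show False using Suc.IH[of 1] False Suc.prems by simp
    qed
  qed
qed simp

text \<open>Descending induction from \<open>N\<close>. The constant sign of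
  \<open>d (Suc k)\<close> makes \<open>d k\<close> monotone, and since neither \<open>d k\<close>
  nor its negative can be bounded away from 0 from above, its limit in the extended reals is 0. This
  is the limit condition under which \<open>karamata\<close> applies.\<close>

lemma higher_derivatives_rv:
  fixes d :: "nat \<Rightarrow> real \<Rightarrow> real"
  assumes der: "\<And>k. k < N \<Longrightarrow> eventually (\<lambda>t. (d k has_real_derivative d (Suc k) t) (at t)) at_top"
    and d1: "(d 1 \<longlongrightarrow> 0) at_top" and rvN: "rv (d N) (\<alpha> - real N)"
    and k: "1 \<le> k" "k \<le> N"
  shows "rv (d k) (\<alpha> - real k) \<and>
    (k < N \<longrightarrow> ((\<lambda>t. t * d (Suc k) t / d k t) \<longlongrightarrow> \<alpha> - real k) at_top)"
  using k(2,1)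
proof (induction rule: inc_induct)
  case base
  then show ?case using rvN by simp
next
  case (step k)
  then have rvS: "rv (d (Suc k)) (\<alpha> - real (Suc k))" by simp
  have "(d k \<longlongrightarrow> 0) at_top"
  proof -
    have neg: "\<not> eventually (\<lambda>t. - d k t \<ge> c) at_top" if "c > 0" for c
    proof (rule higher_derivative_not_bounded_away[where d = "\<lambda>k t. - d k t" and N = N])
      show "eventually (\<lambda>t. ((\<lambda>t. - d k t) has_real_derivative - d (Suc k) t) (at t)) at_top"
        if "k < N" for k
        using der[OF that] by eventually_elim (rule DERIV_minus)
      show "((\<lambda>t. - d 1 t) \<longlongrightarrow> 0) at_top" using tendsto_minus[OF d1] by simp
    qed (use step that in auto)
    have pos: "\<not> eventually (\<lambda>t. d k t \<ge> c) at_top" if "c > 0" for c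
      by (rule higher_derivative_not_bounded_away[OF der d1]) (use step that in auto)
    have "eventually_const_sign (d (Suc k))" using rvS by (simp add: rv_def)
    from monotone_limit_cases[OF der[OF step.hyps(2)] this]
    show ?thesis
    proof (elim disjE exE)
      fix c assume c: "(d k \<longlongrightarrow> c) at_top"
      have "c = 0"
      proof (rule ccontr)
        assume "c \<noteq> 0"
        show False
        proof (cases "c > 0")
          case True
          then have "eventually (\<lambda>t. d k t > c / 2) at_top" using order_tendstoD(1)[OF c, of "c / 2"] by simp
          then have "eventually (\<lambda>t. d k t \<ge> c / 2) at_top" by eventually_elim simp
          then show False using pos[of "c / 2"] True half_gt_zero by blast
        next
          case False
          then have "eventually (\<lambda>t. d k t < c / 2) at_top"
            using order_tendstoD(2)[OF c, of "c / 2"] \<open>c \<noteq> 0\<close> by simp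
          then have "eventually (\<lambda>t. - d k t \<ge> - c / 2) at_top" by eventually_elim simp
          moreover have "- c / 2 > 0" using False \<open>c \<noteq> 0\<close> by simp
          ultimately show False using neg by blast
        qed
      qed
      with c show ?thesis by simp
    next
      assume "filterlim (d k) at_top at_top"
      then show ?thesis using pos[of 1] by (simp add: filterlim_at_top)
    next
      assume "filterlim (d k) at_bot at_top"
      then have "eventually (\<lambda>t. d k t \<le> - 1) at_top" unfolding filterlim_at_bot by blast
      then have "eventually (\<lambda>t. - d k t \<ge> 1) at_top" by eventually_elim simp
      then show ?thesis using neg[of 1] by simp
    qed
  qed
  then show ?case using karamata[OF der[OF step.hyps(2)] rvS] by simp
qed

text \<open>Since \<open>2 powr \<rho> > 1\<close>, doubling the argument eventually never decreases
  \<open>\<bar>F\<bar>\<close>, so it stays above a positive constant along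
  \<open>2 ^ k * T\<close>.\<close>

lemma rv_pos_index_not_tendsto_0:
  assumes "rv F \<rho>" "\<rho> > 0"
  shows "\<not> (F \<longlongrightarrow> 0) at_top"
proof
  assume lim: "(F \<longlongrightarrow> 0) at_top"
  have "((\<lambda>t. \<bar>F (2 * t) / F t\<bar>) \<longlongrightarrow> \<bar>2 powr \<rho>\<bar>) at_top"
    using assms(1) by (intro tendsto_intros) (simp add: rv_def)
  moreover have "1 < \<bar>2 powr \<rho>\<bar>" using assms(2) by simp
  ultimately have "eventually (\<lambda>t. \<bar>F (2 * t) / F t\<bar> > 1) at_top" by (rule order_tendstoD(1))
  moreover have "eventually (\<lambda>t. F t \<noteq> 0) at_top"
    using assms(1) eventually_const_sign_nonzero by (simp add: rv_def)
  ultimately have "eventually (\<lambda>t. t > 0 \<and> F t \<noteq> 0 \<and> \<bar>F (2 * t)\<bar> \<ge> \<bar>F t\<bar>) at_top"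
    using eventually_gt_at_top[of 0] by eventually_elim (auto simp: abs_divide field_simps)
  then obtain T where T: "\<And>t. t \<ge> T \<Longrightarrow> t > 0 \<and> F t \<noteq> 0 \<and> \<bar>F (2 * t)\<bar> \<ge> \<bar>F t\<bar>"
    by (auto simp: eventually_at_top_linorder)
  have Tp: "T > 0" using T[of T] by simp
  have ge: "\<bar>F (2 ^ k * T)\<bar> \<ge> \<bar>F T\<bar>" for k
  proof (induction k)
    case (Suc k)
    have "1 * T \<le> 2 ^ k * T" using Tp by (intro mult_right_mono) auto
    then have "\<bar>F (2 * (2 ^ k * T))\<bar> \<ge> \<bar>F (2 ^ k * T)\<bar>" using T by simp
    then show ?case using Suc by (simp add: mult.assoc)
  qed simp
  have "eventually (\<lambda>t. \<bar>F t\<bar> < \<bar>F T\<bar>) at_top"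
    using tendstoD[OF lim, of "\<bar>F T\<bar>"] T[of T] by simp
  then obtain S where S: "\<And>t. t \<ge> S \<Longrightarrow> \<bar>F t\<bar> < \<bar>F T\<bar>" by (auto simp: eventually_at_top_linorder)
  obtain k where "S / T < 2 ^ k" using real_arch_pow[of 2 "S / T"] by auto
  then have "S \<le> 2 ^ k * T" using Tp by (simp add: field_simps)
  then show False using S ge[of k] by fastforce
qed

text \<open>If \<open>F\<close> tends to 0 or to infinity, \<open>karamata\<close> gives
  \<open>\<beta> = \<alpha>\<close>. If it tends to \<open>c \<noteq> 0\<close>,
  \<open>karamata\<close> applies to \<open>F - c\<close>: the limit 0 of this function forces
  \<open>\<alpha> \<le> 0\<close>, and \<open>(F - c) / F \<rightarrow> 0\<close> forces
  \<open>\<beta> = 0\<close>.\<close>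

lemma log_derivative_limit:
  assumes der: "eventually (\<lambda>t. (F has_real_derivative G t) (at t)) at_top"
    and rvG: "rv G (\<alpha> - 1)" and pos: "eventually (\<lambda>t. F t > 0) at_top"
  obtains \<beta> where "\<beta> = \<alpha> \<or> \<beta> = 0 \<and> \<alpha> \<le> 0" "((\<lambda>t. t * G t / F t) \<longlongrightarrow> \<beta>) at_top"
    "slowly_oscillating F"
proof -
  note result = that
  have kar: thesis if "(F \<longlongrightarrow> 0) at_top \<or> filterlim F at_top at_top"
    using result[of \<alpha>] karamata[OF der rvG that] rv_slowly_oscillating by simp
  have "\<not> filterlim F at_bot at_top"
  proof
    assume "filterlim F at_bot at_top"
    then have "eventually (\<lambda>t. F t \<le> 0) at_top" unfolding filterlim_at_bot by blast
    with pos have "eventually (\<lambda>t::real. False) at_top" by eventually_elim simp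
    then show False by simp
  qed
  moreover have "eventually_const_sign G" using rvG by (simp add: rv_def)
  ultimately consider c where "(F \<longlongrightarrow> c) at_top" "c \<noteq> 0" | "(F \<longlongrightarrow> 0) at_top \<or> filterlim F at_top at_top"
    using monotone_limit_cases[OF der] by metis
  then show thesis
  proof cases
    case 1
    have der': "eventually (\<lambda>t. ((\<lambda>t. F t - c) has_real_derivative G t) (at t)) at_top"
      using der by eventually_elim (auto intro!: derivative_eq_intros)
    have lim0: "((\<lambda>t. F t - c) \<longlongrightarrow> 0) at_top" using 1(1) by (simp add: LIM_zero)
    have k: "rv (\<lambda>t. F t - c) \<alpha>" "((\<lambda>t. t * G t / (F t - c)) \<longlongrightarrow> \<alpha>) at_top"
      using karamata[OF der' rvG] lim0 by auto
    have "\<alpha> \<le> 0" using rv_pos_index_not_tendsto_0[OF k(1)] lim0 by force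
    moreover have "((\<lambda>t. t * G t / F t) \<longlongrightarrow> 0) at_top"
    proof -
      have "((\<lambda>t. t * G t / (F t - c) * (F t - c) / F t) \<longlongrightarrow> \<alpha> * 0 / c) at_top"
        by (intro tendsto_intros k lim0 1)
      then have l: "((\<lambda>t. t * G t / (F t - c) * (F t - c) / F t) \<longlongrightarrow> 0) at_top" by simp
      have "eventually (\<lambda>t. F t - c \<noteq> 0) at_top"
        using k(1) by (intro eventually_const_sign_nonzero) (simp add: rv_def)
      then show ?thesis by (intro Lim_transform_eventually[OF l]) (auto elim: eventually_mono)
    qed
    ultimately show thesis using that slowly_oscillating_tendsto[OF 1] by blast
  next
    case 2
    then show thesis by (rule kar)
  qed
qed

text \<open>
  For \<open>u\<^sub>k = t d\<^sub>k\<^sub>+\<^sub>1 / d\<^sub>k\<close> one has \<open>\<theta> u\<^sub>k = u\<^sub>k (1 + u\<^sub>k\<^sub>+\<^sub>1 - u\<^sub>k)\<close>.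
\<close>

lemma asymp_const_log_derivatives:
  fixes d :: "nat \<Rightarrow> real \<Rightarrow> real"
  assumes der: "\<And>k. k < N \<Longrightarrow> eventually (\<lambda>t. (d k has_real_derivative d (Suc k) t) (at t)) at_top"
    and nz: "\<And>k. k \<le> N \<Longrightarrow> eventually (\<lambda>t. d k t \<noteq> 0) at_top"
    and lim: "\<And>k. k < N \<Longrightarrow> ((\<lambda>t. t * d (Suc k) t / d k t) \<longlongrightarrow> l k) at_top"
    and l: "\<And>k. Suc k < N \<Longrightarrow> l k * (1 + l (Suc k) - l k) = 0"
    and "k + m < N"
  shows "asymp_const m (\<lambda>t. t * d (Suc k) t / d k t) (l k)"
  using assms(5)
proof (induction m arbitrary: k)
  case 0
  then show ?case using lim by simp
next
  case (Suc m)
  define u where "u = (\<lambda>k t. t * d (Suc k) t / d k t)"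
  have u: "asymp_const m (u k) (l k)" "asymp_const m (u (Suc k)) (l (Suc k))"
    using Suc.IH[of k] Suc.IH[of "Suc k"] Suc.prems unfolding u_def by auto
  have "asymp_const m (\<lambda>t. u k t * (1 + u (Suc k) t - u k t)) (l k * (1 + l (Suc k) - l k))"
    by (intro asymp_const_mult asymp_const_diff asymp_const_add asymp_const_const u)
  \<comment> \<open>The assumption on \<open>l\<close> is exactly that this limit vanishes:
    consecutive limits drop by one unless \<open>l k = 0\<close>.\<close>
  then have "asymp_const m (\<lambda>t. u k t * (1 + u (Suc k) t - u k t)) 0" using l Suc.prems by simp
  moreover have "eventually (\<lambda>t. (u k has_real_derivative u k t * (1 + u (Suc k) t - u k t) / t) (at t)) at_top"
  proof -
    have "k < N" "Suc k < N" "k \<le> N" "Suc k \<le> N" using Suc.prems by auto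
    from der[OF this(1)] der[OF this(2)] nz[OF this(3)] nz[OF this(4)] eventually_gt_at_top[of 0]
    show ?thesis
    proof eventually_elim
      case (elim t)
      show ?case unfolding u_def
        by (rule derivative_eq_intros elim refl)+ (use elim in \<open>simp_all add: field_simps power2_eq_square\<close>)
    qed
  qed
  moreover have "(u k \<longlongrightarrow> l k) at_top" using lim Suc.prems unfolding u_def by simp
  ultimately show ?case by (auto simp: u_def)
qed

subsection \<open>The functions \<open>q\<^sub>i\<close> near infinity\<close>

text \<open>To be read with \<open>N = n - 1\<close>, \<open>d k\<close> the \<open>k\<close>-th
  derivative of \<open>q\<close>, \<open>Q i\<close> the function \<open>q_i\<close> and
  \<open>Q' i\<close> its derivative, all relations being required only near infinity. The induction
  on \<open>i\<close> carries the sign, the slow oscillation and the logarithmic derivative of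
  \<open>Q i\<close> together.\<close>

lemma iterated_rates:
  fixes d Q Q' :: "nat \<Rightarrow> real \<Rightarrow> real"
  assumes N: "N \<ge> 1"
    and der: "\<And>k. k < N \<Longrightarrow> eventually (\<lambda>t. (d k has_real_derivative d (Suc k) t) (at t)) at_top"
    and d1: "(d 1 \<longlongrightarrow> 0) at_top" and rvN: "rv (d N) (\<alpha> - real N)"
    and pos: "eventually (\<lambda>t. d 0 t > 0) at_top"
    and \<alpha>: "\<And>m. m \<in> {2..N} \<Longrightarrow> \<alpha> \<noteq> (real m - 1) / real m"
    and Q1: "eventually (\<lambda>t. Q 1 t = d 0 t) at_top"
    and derQ: "\<And>i. i \<in> {1..N} \<Longrightarrow> eventually (\<lambda>t. (Q i has_real_derivative Q' i t) (at t)) at_top"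
    and Q_Suc: "\<And>i. i \<in> {1..N} \<Longrightarrow> eventually (\<lambda>t. Q (Suc i) t = d 0 t * Q' i t) at_top"
  shows "(\<forall>i\<in>{1..Suc N}. eventually_const_sign (Q i)) \<and>
    (\<forall>i\<in>{1..N}. ((\<lambda>t. Q (Suc i) t / Q i t) \<longlongrightarrow> 0) at_top) \<and> slowly_oscillating (Q (Suc N))"
proof -
  have hd: "rv (d k) (\<alpha> - real k) \<and>
      (k < N \<longrightarrow> ((\<lambda>t. t * d (Suc k) t / d k t) \<longlongrightarrow> \<alpha> - real k) at_top)" if "1 \<le> k" "k \<le> N" for k
    by (rule higher_derivatives_rv[where d = d, OF der d1 rvN that])
  have der0: "eventually (\<lambda>t. (d 0 has_real_derivative d 1 t) (at t)) at_top" using der[of 0] N by simp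
  have rv1: "rv (d 1) (\<alpha> - 1)" using hd[of 1] N by simp
  obtain \<beta> where \<beta>: "\<beta> = \<alpha> \<or> \<beta> = 0 \<and> \<alpha> \<le> 0" "((\<lambda>t. t * d 1 t / d 0 t) \<longlongrightarrow> \<beta>) at_top"
    and SO0: "slowly_oscillating (d 0)"
    using log_derivative_limit[OF der0 rv1 pos] .
  have sign0: "eventually_const_sign (d 0)" using pos by (simp add: eventually_const_sign_def)
  have sign: "eventually_const_sign (d k)" if "k \<le> N" for k
    using hd[of k] sign0 that by (cases "k = 0") (auto simp: rv_def)
  define l where "l = (\<lambda>k. if k = 0 then \<beta> else \<alpha> - real k)"
  define u where "u = (\<lambda>k t. t * d (Suc k) t / d k t)"
  have u: "asymp_const m (u k) (l k)" if "k + m < N" for k m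
    unfolding u_def
  proof (rule asymp_const_log_derivatives[where d = d and N = N, OF der])
    show "((\<lambda>t. t * d (Suc k) t / d k t) \<longlongrightarrow> l k) at_top" if "k < N" for k
      using hd[of k] \<beta>(2) that by (cases "k = 0") (auto simp: l_def)
    \<comment> \<open>For \<open>k > 0\<close> the second factor vanishes. For \<open>k = 0\<close>
      both alternatives for \<beta> work: \<open>\<beta> = 0\<close> kills the first factor and
      \<open>\<beta> = \<alpha>\<close> the second.\<close>
    show "l k * (1 + l (Suc k) - l k) = 0" if "Suc k < N" for k
      using \<beta>(1) by (auto simp: l_def algebra_simps)
  qed (use that sign in \<open>auto intro: eventually_const_sign_nonzero\<close>)
  have d0t: "((\<lambda>t. d 0 t / t) \<longlongrightarrow> 0) at_top"
    by (rule tendsto_ratio_zero_of_deriv[OF der0 d1])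
  define \<rho> where "\<rho> = (\<lambda>i. (real i - 1) * \<beta> + \<alpha> - (real i - 1))"
  \<comment> \<open>For \<open>\<beta> = \<alpha>\<close> the value is
    \<open>i * \<alpha> - (i - 1)\<close>, zero exactly at an excluded \<alpha>; for
    \<open>\<beta> = 0\<close> it is \<open>\<alpha> - (i - 1)\<close>, negative because
    \<open>\<alpha> \<le> 0\<close> and \<open>i \<ge> 2\<close>.\<close>
  have \<rho>_nz: "\<rho> i \<noteq> 0" if "i \<in> {2..N}" for i
  proof (cases "\<beta> = \<alpha>")
    case True
    have "\<rho> i = real i * \<alpha> - (real i - 1)" by (simp add: \<rho>_def True algebra_simps)
    then show ?thesis using \<alpha>[OF that] that by (auto simp: field_simps)
  next
    case False
    then show ?thesis using \<beta>(1) that by (auto simp: \<rho>_def)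
  qed
  have Q2_eq: "eventually (\<lambda>t. d 0 t * d 1 t = Q 2 t) at_top"
  proof -
    have "eventually (\<lambda>t. (d 0 has_real_derivative Q' 1 t) (at t)) at_top"
      by (rule eventually_has_real_derivative_cong[OF derQ Q1]) (use N in auto)
    moreover have "eventually (\<lambda>t. Q 2 t = d 0 t * Q' 1 t) at_top"
      using Q_Suc[of 1] N by (simp add: numeral_2_eq_2)
    ultimately show ?thesis using der0
    proof eventually_elim
      case (elim t)
      then have "Q' 1 t = d 1 t" by (intro DERIV_unique)
      then show ?case using elim(2) by simp
    qed
  qed
  \<comment> \<open>The order \<open>N - i\<close> is the supply of further \<theta>-derivatives of
    \<open>v\<close>; each passage from \<open>i\<close> to \<open>Suc i\<close> uses up one of
    them.\<close>
  define P where "P = (\<lambda>i. eventually_const_sign (Q i) \<and> slowly_oscillating (Q i) \<and>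
    (\<exists>v. asymp_const (N - i) v (\<rho> i) \<and>
      eventually (\<lambda>t. (Q i has_real_derivative Q i t * v t / t) (at t)) at_top))"
  have sign2: "eventually_const_sign (Q 2)" and SO2: "slowly_oscillating (Q 2)"
    using eventually_const_sign_cong[OF eventually_const_sign_mult[OF sign0] Q2_eq]
      slowly_oscillating_cong[OF slowly_oscillating_mult[OF SO0 rv_slowly_oscillating[OF rv1]] Q2_eq]
      rv1 by (auto simp: rv_def)
  \<comment> \<open>Uniqueness of the derivative identifies \<open>Q' i\<close>. The four factors
    are kept apart so that sign and slow oscillation pass to the product one factor at a
    time.\<close>
  have next_eq: "eventually (\<lambda>t. d 0 t * Q i t * v t * (1 / t) = Q (Suc i) t) at_top"
    if "i \<in> {1..N}" "eventually (\<lambda>t. (Q i has_real_derivative Q i t * v t / t) (at t)) at_top" for i v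
    using derQ[OF that(1)] Q_Suc[OF that(1)] that(2)
  proof eventually_elim
    case (elim t)
    then have "Q' i t = Q i t * v t / t" using DERIV_unique by blast
    then show ?case using elim by simp
  qed
  have P_next: "eventually_const_sign (Q (Suc i)) \<and> slowly_oscillating (Q (Suc i)) \<and>
      ((\<lambda>t. Q (Suc i) t / Q i t) \<longlongrightarrow> 0) at_top" if i: "i \<in> {2..N}" and P: "P i" for i
  proof -
    obtain v where v: "asymp_const (N - i) v (\<rho> i)"
      "eventually (\<lambda>t. (Q i has_real_derivative Q i t * v t / t) (at t)) at_top"
      using P unfolding P_def by blast
    have eq: "eventually (\<lambda>t. d 0 t * Q i t * v t * (1 / t) = Q (Suc i) t) at_top"
      using next_eq[OF _ v(2)] i by simp
    have vlim: "(v \<longlongrightarrow> \<rho> i) at_top" by (rule asymp_const_tendsto[OF v(1)])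
    have "eventually_const_sign (\<lambda>t. 1 / t :: real)"
      unfolding eventually_const_sign_def using eventually_gt_at_top[of 0]
      by (auto elim: eventually_mono)
    then have "eventually_const_sign (\<lambda>t. d 0 t * Q i t * v t * (1 / t))"
      using P eventually_const_sign_tendsto[OF vlim \<rho>_nz[OF i]]
      by (intro eventually_const_sign_mult sign0) (auto simp: P_def)
    moreover have "slowly_oscillating (\<lambda>t. d 0 t * Q i t * v t * (1 / t))"
      using P slowly_oscillating_tendsto[OF vlim \<rho>_nz[OF i]]
      by (intro slowly_oscillating_mult SO0 slowly_oscillating_inverse_ident) (auto simp: P_def)
    moreover have "((\<lambda>t. Q (Suc i) t / Q i t) \<longlongrightarrow> 0) at_top"
    proof -
      have l: "((\<lambda>t. d 0 t / t * v t) \<longlongrightarrow> 0 * \<rho> i) at_top" by (intro tendsto_mult d0t vlim)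
      have "eventually (\<lambda>t. Q i t \<noteq> 0) at_top"
        using P by (auto simp: P_def intro: eventually_const_sign_nonzero)
      with eq have "eventually (\<lambda>t. d 0 t / t * v t = Q (Suc i) t / Q i t) at_top"
      proof eventually_elim
        case (elim t)
        then show ?case by (simp add: elim(1)[symmetric])
      qed
      with l show ?thesis by (simp add: tendsto_cong)
    qed
    ultimately show ?thesis
      using eventually_const_sign_cong[OF _ eq] slowly_oscillating_cong[OF _ eq] by blast
  qed
  have P: "P i" if "2 \<le> i" "i \<le> N" for i
    using that
  proof (induction i rule: dec_induct)
    case base
    \<comment> \<open>As \<open>Q 2\<close> is \<open>d 0 * d 1\<close>, its logarithmic derivative
      is \<open>u 0 + u 1\<close>; the second summand is available up to order
      \<open>N - 2\<close>.\<close>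
    have "asymp_const (N - 2) (\<lambda>t. u 0 t + u 1 t) (l 0 + l 1)"
      using base by (intro asymp_const_add u) auto
    moreover have "l 0 + l 1 = \<rho> 2" by (simp add: l_def \<rho>_def)
    moreover have "eventually (\<lambda>t. (Q 2 has_real_derivative Q 2 t * (u 0 t + u 1 t) / t) (at t)) at_top"
    proof (rule eventually_has_real_derivative_cong[OF _ Q2_eq])
      show "eventually (\<lambda>t. ((\<lambda>t. d 0 t * d 1 t) has_real_derivative d 1 t * d 1 t + d 2 t * d 0 t) (at t)) at_top"
      proof -
        have "eventually (\<lambda>t. (d 1 has_real_derivative d 2 t) (at t)) at_top"
          using der[of 1] base by (simp add: numeral_2_eq_2)
        with der0 show ?thesis by eventually_elim (rule DERIV_mult)
      qed
      show "eventually (\<lambda>t. d 1 t * d 1 t + d 2 t * d 0 t = Q 2 t * (u 0 t + u 1 t) / t) at_top"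
        using Q2_eq eventually_const_sign_nonzero[OF sign0] eventually_const_sign_nonzero[OF sign[of 1, OF N]]
          eventually_gt_at_top[of 0]
      proof eventually_elim
        case (elim t)
        then show ?case
          unfolding elim(1)[symmetric] u_def by (simp add: field_simps numeral_2_eq_2)
      qed
    qed
    ultimately show ?case unfolding P_def using sign2 SO2 by auto
  next
    case (step i)
    then have Pi: "P i" and i: "i \<in> {2..N}" by auto
    obtain v where v: "asymp_const (N - i) v (\<rho> i)"
      and dQ: "eventually (\<lambda>t. (Q i has_real_derivative Q i t * v t / t) (at t)) at_top"
      using Pi unfolding P_def by blast
    define m where "m = N - Suc i"
    have m: "N - i = Suc m" using step by (simp add: m_def)
    obtain w where w: "asymp_const m w 0"
      and dv: "eventually (\<lambda>t. (v has_real_derivative w t / t) (at t)) at_top"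
      using v[unfolded m asymp_const.simps] by blast
    have vm: "asymp_const m v (\<rho> i)" by (rule asymp_const_SucD[OF v[unfolded m]])
    have um: "asymp_const m (u 0) (l 0)" using m by (intro u) simp
    \<comment> \<open>Logarithmic differentiation of \<open>d 0 * Q i * v / t\<close>, multiplied by
      \<open>t\<close>: the factors contribute \<open>u 0\<close>, \<open>v\<close>,
      \<open>w / v\<close> with \<open>w = \<theta> v\<close>, and -1.\<close>
    define v' where "v' = (\<lambda>t. v t + u 0 t - 1 + w t * inverse (v t))"
    have "asymp_const m v' (\<rho> i + l 0 - 1 + 0 * inverse (\<rho> i))"
      unfolding v'_def
      by (rule asymp_const_add[OF asymp_const_diff[OF asymp_const_add[OF vm um] asymp_const_const]
            asymp_const_mult[OF w asymp_const_inverse[OF vm \<rho>_nz[OF i]]]])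
    moreover have "\<rho> i + l 0 - 1 + 0 * inverse (\<rho> i) = \<rho> (Suc i)" by (simp add: \<rho>_def l_def algebra_simps)
    ultimately have v': "asymp_const (N - Suc i) v' (\<rho> (Suc i))" by (simp add: m_def)
    have eq: "eventually (\<lambda>t. d 0 t * Q i t * v t * (1 / t) = Q (Suc i) t) at_top"
      using next_eq[OF _ dQ] i by simp
    have vnz: "eventually (\<lambda>t. v t \<noteq> 0) at_top"
      by (rule tendsto_imp_eventually_ne[OF asymp_const_tendsto[OF v] \<rho>_nz[OF i]])
    have "eventually (\<lambda>t. (Q (Suc i) has_real_derivative Q (Suc i) t * v' t / t) (at t)) at_top"
    proof (rule eventually_has_real_derivative_cong[OF _ eq])
      show "eventually (\<lambda>t. ((\<lambda>t. d 0 t * Q i t * v t * (1 / t)) has_real_derivative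
          d 0 t * Q i t * v t * (1 / t) * v' t / t) (at t)) at_top"
        using der0 dQ dv vnz eventually_const_sign_nonzero[OF sign0] eventually_gt_at_top[of 0]
      proof eventually_elim
        case (elim t)
        have "((\<lambda>t. 1 / t) has_real_derivative - 1 / (t * t)) (at t)"
          using elim by (auto intro!: derivative_eq_intros)
        from DERIV_mult[OF DERIV_mult[OF DERIV_mult[OF elim(1,2)] elim(3)] this]
        show ?case unfolding v'_def u_def
          by (rule DERIV_cong) (use elim in \<open>simp add: field_simps\<close>)
      qed
      show "eventually (\<lambda>t. d 0 t * Q i t * v t * (1 / t) * v' t / t = Q (Suc i) t * v' t / t) at_top"
        using eq by eventually_elim simp
    qed
    then show ?case using P_next[OF i Pi] v' unfolding P_def by blast
  qed
  \<comment> \<open>The index 1 is treated apart because the logarithmic derivative of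
    \<open>Q 1\<close> tends to \<beta>, which may be 0; the ratio is simply
    \<open>d 1\<close>.\<close>
  have ratio1: "((\<lambda>t. Q (Suc 1) t / Q 1 t) \<longlongrightarrow> 0) at_top"
  proof (rule Lim_transform_eventually[OF d1])
    show "eventually (\<lambda>t. d 1 t = Q (Suc 1) t / Q 1 t) at_top"
      using Q2_eq Q1 eventually_const_sign_nonzero[OF sign0]
    proof eventually_elim
      case (elim t)
      then show ?case by (simp add: elim(1)[symmetric] numeral_2_eq_2[symmetric])
    qed
  qed
  have sign1: "eventually_const_sign (Q 1)"
    using Q1 by (intro eventually_const_sign_cong[OF sign0]) (simp add: eq_commute)
  have "eventually_const_sign (Q i)" if i: "i \<in> {1..Suc N}" for i
  proof -
    consider "i = 1" | "i = 2" | j where "i = Suc j" "j \<in> {2..N}"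
    proof -
      have "i = 1 \<or> i = 2 \<or> (\<exists>j. i = Suc j \<and> j \<in> {2..N})"
        using i by (cases i) auto
      then show thesis using that by blast
    qed
    then show ?thesis using sign1 sign2 P_next P by cases auto
  qed
  moreover have "((\<lambda>t. Q (Suc i) t / Q i t) \<longlongrightarrow> 0) at_top" if "i \<in> {1..N}" for i
    using that P_next[of i] P[of i] ratio1 by (cases "i = 1") auto
  moreover have "slowly_oscillating (Q (Suc N))"
    using P_next[of N] P[of N] SO2 N by (cases "N = 1") (auto simp: numeral_2_eq_2)
  ultimately show ?thesis by blast
qed

subsection \<open>The slowly varying inverse\<close>

text \<open>Since \<open>ln A\<close> has derivative \<open>1 / q\<close>, it grows by
  \<open>(\<kappa> - 1) * t / q \<xi>\<close> from \<open>t\<close> to \<open>\<kappa> * t\<close>,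
  and this is unbounded because \<open>q\<close> is small against the identity.\<close>

lemma rapid_growth:
  assumes der: "eventually (\<lambda>t. (A has_real_derivative A t / q t) (at t)) at_top"
    and pos: "eventually (\<lambda>t. A t > 0) at_top" "eventually (\<lambda>t. q t > 0) at_top"
    and q: "((\<lambda>t. q t / t) \<longlongrightarrow> 0) at_top" and "\<kappa> > 1" "M > 1"
  shows "eventually (\<lambda>t. M * A t \<le> A (\<kappa> * t)) at_top"
proof -
  \<comment> \<open>Together with \<open>q \<xi> \<le> e * (\<kappa> * t)\<close> this makes the
    growth of \<open>ln A\<close> at least \<open>ln M\<close>.\<close>
  define e where "e = (\<kappa> - 1) / (\<kappa> * ln M)"
  have e: "e > 0" using assms by (simp add: e_def)
  have "eventually (\<lambda>t. q t / t < e) at_top" using order_tendstoD(2)[OF q e] .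
  with der pos eventually_gt_at_top[of 0] have
    "eventually (\<lambda>t. (A has_real_derivative A t / q t) (at t) \<and> A t > 0 \<and> q t > 0 \<and> q t \<le> e * t) at_top"
    by eventually_elim (auto simp: field_simps)
  then obtain T where T: "\<And>t. t \<ge> T \<Longrightarrow> (A has_real_derivative A t / q t) (at t)"
    "\<And>t. t \<ge> T \<Longrightarrow> A t > 0" "\<And>t. t \<ge> T \<Longrightarrow> q t > 0" "\<And>t. t \<ge> T \<Longrightarrow> q t \<le> e * t"
    by (auto simp: eventually_at_top_linorder)
  show ?thesis using eventually_ge_at_top[of T] eventually_gt_at_top[of 0]
  proof eventually_elim
    case (elim t)
    have lt: "t < \<kappa> * t" using elim \<open>\<kappa> > 1\<close> by simp
    have "((\<lambda>t. ln (A t)) has_real_derivative 1 / q s) (at s)" if "s \<ge> T" for s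
      using T(1-3)[OF that] by (auto intro!: derivative_eq_intros)
    with lt elim obtain \<xi> where \<xi>: "t < \<xi>" "\<xi> < \<kappa> * t"
      "ln (A (\<kappa> * t)) - ln (A t) = (\<kappa> * t - t) * (1 / q \<xi>)"
      using MVT2[of t "\<kappa> * t" "\<lambda>t. ln (A t)" "\<lambda>s. 1 / q s"] by auto
    have "q \<xi> \<le> e * \<xi>" using T(4) \<xi> elim by simp
    also have "\<dots> \<le> e * (\<kappa> * t)" using \<xi> e by (intro mult_left_mono) auto
    finally have "q \<xi> \<le> (\<kappa> - 1) * t / ln M" using \<open>\<kappa> > 1\<close> by (simp add: e_def)
    then have "ln M * q \<xi> \<le> (\<kappa> - 1) * t" using \<open>M > 1\<close> by (simp add: field_simps)
    then have "ln M \<le> (\<kappa> * t - t) * (1 / q \<xi>)" using T(3)[of \<xi>] \<xi> elim by (simp add: field_simps)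
    then have "ln M + ln (A t) \<le> ln (A (\<kappa> * t))" using \<xi> by simp
    moreover have "A t > 0" "A (\<kappa> * t) > 0" using T(2)[of t] T(2)[of "\<kappa> * t"] elim lt by auto
    ultimately have "ln (M * A t) \<le> ln (A (\<kappa> * t))" using \<open>M > 1\<close> by (simp add: ln_mult)
    then show ?case using \<open>A t > 0\<close> \<open>A (\<kappa> * t) > 0\<close> \<open>M > 1\<close> by simp
  qed
qed

text \<open>In the coordinate \<open>s = ln t\<close>, the function \<open>ln (A (exp s))\<close>
  has derivative \<open>exp s / q (exp s)\<close>, eventually at least 1.\<close>

lemma rapid_growth_at_top:
  assumes der: "eventually (\<lambda>t. (A has_real_derivative A t / q t) (at t)) at_top"
    and pos: "eventually (\<lambda>t. A t > 0) at_top" "eventually (\<lambda>t. q t > 0) at_top"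
    and q: "((\<lambda>t. q t / t) \<longlongrightarrow> 0) at_top"
  shows "filterlim A at_top at_top"
proof -
  have "eventually (\<lambda>t. q t / t < 1) at_top" using order_tendstoD(2)[OF q] by simp
  with der pos eventually_gt_at_top[of 0] have
    "eventually (\<lambda>t. (A has_real_derivative A t / q t) (at t) \<and> A t > 0 \<and> q t > 0 \<and> q t \<le> t \<and> t > 0) at_top"
    by eventually_elim (auto simp: field_simps)
  then have ev: "eventually (\<lambda>s. (A has_real_derivative A (exp s) / q (exp s)) (at (exp s)) \<and>
      A (exp s) > 0 \<and> q (exp s) > 0 \<and> q (exp s) \<le> exp s \<and> exp s > 0) at_top"
    by (rule eventually_compose_filterlim[OF _ exp_at_top])
  have "filterlim (\<lambda>s. ln (A (exp s))) at_top at_top"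
  proof (rule filterlim_at_top_deriv_ge)
    show "eventually (\<lambda>s. ((\<lambda>s. ln (A (exp s))) has_real_derivative exp s / q (exp s)) (at s)) at_top"
      using ev
    proof eventually_elim
      case (elim s)
      then have "((\<lambda>s. A (exp s)) has_real_derivative A (exp s) / q (exp s) * exp s) (at s)"
        by (intro DERIV_chain2[where f = A and g = exp] DERIV_exp) auto
      from DERIV_chain2[where f = ln, OF DERIV_ln this] elim show ?case
        by (simp add: inverse_eq_divide)
    qed
    show "eventually (\<lambda>s. exp s / q (exp s) \<ge> 1) at_top" using ev by eventually_elim simp
  qed simp
  then have "filterlim (\<lambda>s. exp (ln (A (exp s)))) at_top at_top"
    by (rule filterlim_compose[OF exp_at_top])
  then have "filterlim (\<lambda>t. exp (ln (A (exp (ln t))))) at_top at_top"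
    by (rule filterlim_compose[OF _ ln_at_top])
  then show ?thesis
  proof (rule filterlim_cong[THEN iffD1, OF refl refl, rotated])
    show "eventually (\<lambda>t. exp (ln (A (exp (ln t)))) = A t) at_top"
      using pos(1) eventually_gt_at_top[of 0] by eventually_elim simp
  qed
qed

text \<open>Rapid growth of \<open>A\<close> read backwards:
  \<open>A (\<kappa> * f t) \<ge> M * t\<close> and \<open>A (f t / \<kappa>) \<le> t / M\<close>,
  so by monotonicity \<open>f\<close> takes arguments between \<open>t / M\<close> and
  \<open>M * t\<close> to values between \<open>f t / \<kappa>\<close> and
  \<open>\<kappa> * f t\<close>.\<close>

lemma inverse_uniformly_slowly_varying:
  fixes A f q :: "real \<Rightarrow> real"
  assumes mono: "\<And>r s. t0 \<le> r \<Longrightarrow> r < s \<Longrightarrow> A r < A s"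
    and inv: "\<And>y. y \<ge> A t0 \<Longrightarrow> f y \<ge> t0 \<and> A (f y) = y"
    and der: "eventually (\<lambda>t. (A has_real_derivative A t / q t) (at t)) at_top"
    and pos: "A t0 > 0" "eventually (\<lambda>t. q t > 0) at_top"
    and q: "((\<lambda>t. q t / t) \<longlongrightarrow> 0) at_top"
    and f: "filterlim f at_top at_top" and "x > 0" "\<delta> > 0"
  shows "eventually (\<lambda>t. \<forall>y. min t (x * t) \<le> y \<and> y \<le> max t (x * t) \<longrightarrow> \<bar>f y - f t\<bar> \<le> \<delta> * f t) at_top"
proof -
  \<comment> \<open>Symmetric in \<open>x\<close> and \<open>1 / x\<close>, so that \<open>t\<close>
    and \<open>x * t\<close> both lie between \<open>t / M\<close> and \<open>M * t\<close>, whether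
    \<open>x\<close> is above or below 1.\<close>
  define M where "M = x + 1 / x"
  have M: "M > 1" "x \<le> M" "1 / M \<le> x"
  proof -
    have "1 / x > 0" using \<open>x > 0\<close> by simp
    moreover have "x > 1 \<or> 1 / x \<ge> 1" using \<open>x > 0\<close> by (auto simp: le_divide_eq)
    ultimately show "M > 1" using \<open>x > 0\<close> unfolding M_def by linarith
    show "x \<le> M" using \<open>x > 0\<close> by (simp add: M_def)
    have "1 / M \<le> 1 / (1 / x)" using \<open>x > 0\<close> by (intro divide_left_mono) (auto simp: M_def add_pos_pos)
    then show "1 / M \<le> x" by simp
  qed
  define \<kappa> where "\<kappa> = 1 + \<delta>"
  have \<kappa>: "\<kappa> > 1" using \<open>\<delta> > 0\<close> by (simp add: \<kappa>_def)
  have "eventually (\<lambda>t. A t > 0) at_top"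
    using eventually_gt_at_top[of t0] by eventually_elim (use mono pos(1) less_trans in blast)
  then have grow: "eventually (\<lambda>t. M * A t \<le> A (\<kappa> * t)) at_top"
    using rapid_growth[OF der _ pos(2) q \<kappa> M(1)] by blast
  have le: "r \<le> s" if "A r \<le> A s" "t0 \<le> s" for r s
    using mono[of s r] that by (cases "r \<le> s") auto
  have "eventually (\<lambda>t. M * A (f t) \<le> A (\<kappa> * f t)) at_top"
    by (rule eventually_compose_filterlim[OF grow f])
  moreover have "eventually (\<lambda>t. M * A (1 / \<kappa> * f t) \<le> A (\<kappa> * (1 / \<kappa> * f t))) at_top"
    by (rule eventually_compose_filterlim[OF eventually_scaled_at_top[OF grow] f]) (use \<kappa> in simp)
  moreover have "eventually (\<lambda>t. f t \<ge> max 1 (max t0 (\<kappa> * t0))) at_top"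
    using f unfolding filterlim_at_top by blast
  moreover have "eventually (\<lambda>t. x * t \<ge> A t0) at_top"
    using filterlim_mult_at_top[OF \<open>x > 0\<close>] unfolding filterlim_at_top by blast
  ultimately show ?thesis
    using eventually_ge_at_top[of "max 1 (A t0)"]
  proof eventually_elim
    case (elim t)
    have t: "t > 0" "A (f t) = t" "f t > 0" "f t \<ge> t0" using inv[of t] elim by auto
    show ?case
    proof (intro allI impI)
      fix y assume y: "min t (x * t) \<le> y \<and> y \<le> max t (x * t)"
      then have "y \<ge> A t0" using elim by auto
      then have fy: "f y \<ge> t0" "A (f y) = y" using inv by auto
      have "x * t \<le> M * t" "1 * t \<le> M * t" "1 / M * t \<le> x * t" "1 / M * t \<le> 1 * t"
        using M t by (auto intro!: mult_right_mono simp del: times_divide_eq_left)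
      then have y': "y \<le> M * t" "1 / M * t \<le> y" using y by auto
      have "f t \<le> \<kappa> * f t" using t \<kappa> by simp
      then have "t0 \<le> \<kappa> * f t" using t by linarith
      moreover have "A (f y) \<le> A (\<kappa> * f t)" using elim(1) t(2) y'(1) fy(2) by simp
      ultimately have "f y \<le> \<kappa> * f t" using le by blast
      moreover have "1 / \<kappa> * f t \<le> f y"
      proof (rule le)
        have "\<kappa> * (1 / \<kappa> * f t) = f t" using \<kappa> by simp
        then have "M * A (1 / \<kappa> * f t) \<le> t" using elim(2) t(2) by simp
        then have "A (1 / \<kappa> * f t) \<le> 1 / M * t" using M(1) by (simp add: field_simps)
        also have "\<dots> \<le> A (f y)" unfolding fy(2) by (rule y'(2))
        finally show "A (1 / \<kappa> * f t) \<le> A (f y)" .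
      qed (rule fy)
      moreover have "(1 - \<delta>) * f t \<le> 1 / \<kappa> * f t"
      proof (rule mult_right_mono)
        have "(1 - \<delta>) * \<kappa> \<le> 1" by (simp add: \<kappa>_def algebra_simps)
        then show "1 - \<delta> \<le> 1 / \<kappa>" using \<kappa> by (simp add: pos_le_divide_eq)
      qed (use t in simp)
      ultimately show "\<bar>f y - f t\<bar> \<le> \<delta> * f t" by (simp add: \<kappa>_def algebra_simps abs_le_iff)
    qed
  qed
qed

subsection \<open>Taylor expansion in logarithmic scale\<close>

text \<open>Uniformity over all points between \<open>t\<close> and \<open>x * t\<close> serves the
  Lagrange remainder, whose intermediate point is unknown.\<close>

definition uniformly_slowly_varying :: "(real \<Rightarrow> real) \<Rightarrow> bool" where
  "uniformly_slowly_varying F \<longleftrightarrow> (\<forall>x>0. \<forall>\<epsilon>>0. eventually (\<lambda>t. \<forall>y.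
     min t (x * t) \<le> y \<and> y \<le> max t (x * t) \<longrightarrow> \<bar>F y - F t\<bar> \<le> \<epsilon> * \<bar>F t\<bar>) at_top)"

lemma uniformly_slowly_varying_compose:
  assumes Q: "slowly_oscillating Q" and f: "filterlim f at_top at_top"
    and unif: "\<And>x \<delta>. x > 0 \<Longrightarrow> \<delta> > 0 \<Longrightarrow> eventually (\<lambda>t. \<forall>y.
        min t (x * t) \<le> y \<and> y \<le> max t (x * t) \<longrightarrow> \<bar>f y - f t\<bar> \<le> \<delta> * f t) at_top"
  shows "uniformly_slowly_varying (\<lambda>y. Q (f y))"
  unfolding uniformly_slowly_varying_def
proof (intro allI impI)
  fix x \<epsilon> :: real assume "x > 0" "\<epsilon> > 0"
  obtain \<delta> where \<delta>: "\<delta> > 0"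
    "eventually (\<lambda>t. \<forall>s. \<bar>s - t\<bar> \<le> \<delta> * t \<longrightarrow> \<bar>Q s - Q t\<bar> \<le> \<epsilon> * \<bar>Q t\<bar>) at_top"
    using Q \<open>\<epsilon> > 0\<close> unfolding slowly_oscillating_def by blast
  from unif[OF \<open>x > 0\<close> \<delta>(1)] eventually_compose_filterlim[OF \<delta>(2) f]
  show "eventually (\<lambda>t. \<forall>y. min t (x * t) \<le> y \<and> y \<le> max t (x * t) \<longrightarrow>
      \<bar>Q (f y) - Q (f t)\<bar> \<le> \<epsilon> * \<bar>Q (f t)\<bar>) at_top"
    by eventually_elim blast
qed

lemma uniformly_slowly_varying_cong:
  assumes "uniformly_slowly_varying F" "eventually (\<lambda>t. F t = G t) at_top"
  shows "uniformly_slowly_varying G"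
  unfolding uniformly_slowly_varying_def
proof (intro allI impI)
  fix x \<epsilon> :: real assume "x > 0" "\<epsilon> > 0"
  obtain T where T: "\<And>t. t \<ge> T \<Longrightarrow> F t = G t" using assms(2) by (auto simp: eventually_at_top_linorder)
  have "eventually (\<lambda>t. \<forall>y. min t (x * t) \<le> y \<and> y \<le> max t (x * t) \<longrightarrow> \<bar>F y - F t\<bar> \<le> \<epsilon> * \<bar>F t\<bar>) at_top"
    using assms(1) \<open>x > 0\<close> \<open>\<epsilon> > 0\<close> unfolding uniformly_slowly_varying_def by blast
  moreover have "eventually (\<lambda>t. x * t \<ge> T) at_top"
    using filterlim_mult_at_top[OF \<open>x > 0\<close>] unfolding filterlim_at_top by blast
  ultimately show "eventually (\<lambda>t. \<forall>y. min t (x * t) \<le> y \<and> y \<le> max t (x * t) \<longrightarrow>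
      \<bar>G y - G t\<bar> \<le> \<epsilon> * \<bar>G t\<bar>) at_top"
    using eventually_ge_at_top[of T]
  proof eventually_elim
    case (elim t)
    show ?case
    proof (intro allI impI)
      fix y assume y: "min t (x * t) \<le> y \<and> y \<le> max t (x * t)"
      then have "y \<ge> T" using elim by auto
      then show "\<bar>G y - G t\<bar> \<le> \<epsilon> * \<bar>G t\<bar>" using elim(1) y T[of y] T[of t] elim(3) by auto
    qed
  qed
qed

text \<open>In the coordinate \<open>s = ln t\<close> the \<open>k\<close>-th derivative of
  \<open>L i\<close> is \<open>L (i + k)\<close>. Taylor's formula at \<open>ln t\<close> with
  increment \<open>ln x\<close> has a remainder with \<open>L n\<close> at a point between
  \<open>t\<close> and \<open>x * t\<close>, and uniform slow variation replaces that value by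
  \<open>L n t\<close>.\<close>

lemma log_taylor_smallo:
  fixes L :: "nat \<Rightarrow> real \<Rightarrow> real"
  assumes der: "\<And>i. i < n \<Longrightarrow> eventually (\<lambda>t. (L i has_real_derivative L (Suc i) t / t) (at t)) at_top"
    and slow: "uniformly_slowly_varying (L n)" and i: "i \<le> n" and x: "x > 0"
  shows "(\<lambda>t. L i (x * t) - (\<Sum>j\<le>n - i. ln x ^ j / fact j * L (i + j) t)) \<in> o[at_top](L n)"
proof (rule landau_o.smallI)
  fix c :: real assume c: "c > 0"
  define m where "m = n - i"
  \<comment> \<open>A bound for the coefficient of the remainder; the summand 1 keeps it positive,
    so that \<open>c / C\<close> is an admissible tolerance.\<close>
  define C where "C = \<bar>ln x\<bar> ^ m / fact m + 1"
  have C: "C > 0" "\<bar>ln x ^ m / fact m\<bar> \<le> C"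
    unfolding C_def by (simp_all add: add_nonneg_pos power_abs abs_divide)
  have "eventually (\<lambda>t. \<forall>k\<in>{..<m}. (L (i + k) has_real_derivative L (Suc (i + k)) t / t) (at t)) at_top"
    by (intro eventually_ball_finite ballI der) (auto simp: m_def)
  then obtain T0 where T0: "\<And>t k. t \<ge> T0 \<Longrightarrow> k < m \<Longrightarrow>
      (L (i + k) has_real_derivative L (Suc (i + k)) t / t) (at t)"
    by (auto simp: eventually_at_top_linorder)
  define T where "T = max T0 1"
  have T: "T > 0" "\<And>t k. t \<ge> T \<Longrightarrow> k < m \<Longrightarrow>
      (L (i + k) has_real_derivative L (Suc (i + k)) t / t) (at t)"
    using T0 by (auto simp: T_def)
  have "eventually (\<lambda>t. \<forall>y. min t (x * t) \<le> y \<and> y \<le> max t (x * t) \<longrightarrow>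
      \<bar>L n y - L n t\<bar> \<le> c / C * \<bar>L n t\<bar>) at_top"
    using slow[unfolded uniformly_slowly_varying_def, rule_format, OF x divide_pos_pos[OF c C(1)]] .
  moreover have "eventually (\<lambda>t. x * t \<ge> T) at_top"
    using filterlim_mult_at_top[OF x] unfolding filterlim_at_top by blast
  ultimately have "eventually (\<lambda>t. \<bar>L i (x * t) - (\<Sum>j\<le>m. ln x ^ j / fact j * L (i + j) t)\<bar> \<le> c * \<bar>L n t\<bar>) at_top"
    using eventually_ge_at_top[of T]
  proof eventually_elim
    case (elim t)
    have t: "t > 0" "x * t > 0" using elim T by auto
    \<comment> \<open>Taylor's theorem asks for a positive order and a nonzero increment; for
      \<open>m = 0\<close> the witness is \<open>x * t\<close>, for \<open>x = 1\<close> it is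
      \<open>t\<close>.\<close>
    have "\<exists>y. min t (x * t) \<le> y \<and> y \<le> max t (x * t) \<and>
        L i (x * t) = (\<Sum>j<m. ln x ^ j / fact j * L (i + j) t) + ln x ^ m / fact m * L n y"
    proof (cases "m = 0 \<or> x = 1")
      case True
      then show ?thesis
      proof
        assume "m = 0"
        then show ?thesis using i by (intro exI[of _ "x * t"]) (simp add: m_def)
      next
        assume "x = 1"
        moreover have "(\<Sum>j<m. ln 1 ^ j / fact j * L (i + j) t) = (\<Sum>j<m. if j = 0 then L i t else 0)"
          by (intro sum.cong) (auto simp: power_0_left)
        ultimately show ?thesis using i
          by (intro exI[of _ t]) (auto simp: m_def power_0_left)
      qed
    next
      case False
      define D where "D = (\<lambda>k s. L (i + k) (exp s))"
      have eq: "exp (ln t) = t" "ln (x * t) = ln x + ln t" "exp (ln x + ln t) = x * t"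
        using t x by (auto simp: ln_mult exp_add)
      have D: "(D k has_real_derivative D (Suc k) s) (at s)"
        if "k < m" "min (ln t) (ln (x * t)) \<le> s" for k s
      proof -
        have "exp (min (ln t) (ln (x * t))) \<le> exp s" using that by simp
        moreover have "exp (min (ln t) (ln (x * t))) = min t (x * t)" using t by (auto simp: min_def)
        ultimately have "exp s \<ge> T" using elim by auto
        from DERIV_chain2[OF T(2)[OF this that(1)] DERIV_exp] show ?thesis by (simp add: D_def)
      qed
      have ne: "ln x + ln t \<noteq> ln t" using False x by simp
      have "\<exists>s. (if ln x + ln t < ln t then ln x + ln t < s \<and> s < ln t else ln t < s \<and> s < ln x + ln t) \<and>
          D 0 (ln x + ln t) = (\<Sum>k<m. D k (ln t) / fact k * (ln x + ln t - ln t) ^ k) +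
            D m s / fact m * (ln x + ln t - ln t) ^ m"
      proof (rule Taylor)
        show "\<forall>k s. k < m \<and> min (ln t) (ln (x * t)) \<le> s \<and> s \<le> max (ln t) (ln (x * t)) \<longrightarrow>
            (D k has_real_derivative D (Suc k) s) (at s)" using D by blast
        show "m > 0" using False by simp
      qed (use False x in \<open>simp_all add: eq(2)\<close>)
      then obtain s0 where s0: "if ln x + ln t < ln t then ln x + ln t < s0 \<and> s0 < ln t
            else ln t < s0 \<and> s0 < ln x + ln t"
          "D 0 (ln x + ln t) = (\<Sum>k<m. D k (ln t) / fact k * (ln x + ln t - ln t) ^ k) +
            D m s0 / fact m * (ln x + ln t - ln t) ^ m" by blast
      have s: "min (ln t) (ln (x * t)) \<le> s0" "s0 \<le> max (ln t) (ln (x * t))"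
        using s0(1) unfolding eq(2) by (simp_all split: if_splits)
      have "D 0 (ln x + ln t) = (\<Sum>k<m. D k (ln t) / fact k * ln x ^ k) + D m s0 / fact m * ln x ^ m"
        using s0(2) by simp
      also have "(\<Sum>k<m. D k (ln t) / fact k * ln x ^ k) = (\<Sum>j<m. ln x ^ j / fact j * L (i + j) t)"
        by (intro sum.cong) (simp_all add: D_def eq(1))
      finally have main: "L i (x * t) = (\<Sum>j<m. ln x ^ j / fact j * L (i + j) t) + ln x ^ m / fact m * L (i + m) (exp s0)"
        by (simp add: D_def eq(3))
      have "exp (min (ln t) (ln (x * t))) \<le> exp s0" "exp s0 \<le> exp (max (ln t) (ln (x * t)))"
        using s by auto
      moreover have "exp (min (ln t) (ln (x * t))) = min t (x * t)" "exp (max (ln t) (ln (x * t))) = max t (x * t)"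
        using t by (auto simp: min_def max_def)
      moreover have "i + m = n" using i by (simp add: m_def)
      ultimately show ?thesis
        using main by (intro exI[of _ "exp s0"]) simp
    qed
    then obtain y where y: "min t (x * t) \<le> y" "y \<le> max t (x * t)"
      "L i (x * t) = (\<Sum>j<m. ln x ^ j / fact j * L (i + j) t) + ln x ^ m / fact m * L n y" by blast
    have "i + m = n" using i by (simp add: m_def)
    \<comment> \<open>The sum over \<open>j \<le> m\<close> has one term more than the sum over
      \<open>j < m\<close>; that term cancels the remainder up to
      \<open>L n y - L n t\<close>.\<close>
    then have "L i (x * t) - (\<Sum>j\<le>m. ln x ^ j / fact j * L (i + j) t) = ln x ^ m / fact m * (L n y - L n t)"
      unfolding y(3) lessThan_Suc_atMost[symmetric] by (simp add: right_diff_distrib diff_divide_distrib)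
    also have "\<bar>\<dots>\<bar> = \<bar>ln x ^ m / fact m\<bar> * \<bar>L n y - L n t\<bar>" by (simp add: abs_mult)
    also have "\<dots> \<le> C * (c / C * \<bar>L n t\<bar>)" using elim(1) y C by (intro mult_mono) auto
    also have "\<dots> = c * \<bar>L n t\<bar>" using C by simp
    finally show ?case .
  qed
  then show "eventually (\<lambda>t. norm (L i (x * t) - (\<Sum>j\<le>n - i. ln x ^ j / fact j * L (i + j) t)) \<le> c * norm (L n t)) at_top"
    by (simp add: m_def)
qed

subsection \<open>Powers of the nilpotent Jordan block\<close>

lemma pow_smult_mat:
  fixes B :: "'a :: comm_semiring_1 mat"
  assumes "B \<in> carrier_mat n n"
  shows "(c \<cdot>\<^sub>m B) ^\<^sub>m k = c ^ k \<cdot>\<^sub>m (B ^\<^sub>m k)"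
proof (induction k)
  case 0
  show ?case using assms by (intro eq_matI) auto
next
  case (Suc k)
  have "(c \<cdot>\<^sub>m B) ^\<^sub>m Suc k = (c ^ k \<cdot>\<^sub>m (B ^\<^sub>m k)) * (c \<cdot>\<^sub>m B)" by (simp add: Suc)
  also have "\<dots> = c ^ k \<cdot>\<^sub>m ((B ^\<^sub>m k) * (c \<cdot>\<^sub>m B))"
    by (rule mult_smult_assoc_mat[of _ n n _ n]) (use assms in \<open>auto intro: pow_carrier_mat\<close>)
  also have "(B ^\<^sub>m k) * (c \<cdot>\<^sub>m B) = c \<cdot>\<^sub>m (B ^\<^sub>m k * B)"
    by (rule mult_smult_distrib[of _ n n _ n]) (use assms in \<open>auto intro: pow_carrier_mat\<close>)
  finally show ?case using assms by (intro eq_matI) (auto simp: mult_ac)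
qed

text \<open>The \<open>k\<close>-th power of the nilpotent block is supported on the
  \<open>k\<close>-th superdiagonal, so the exponential series at an entry reduces to the term
  \<open>k = j - i\<close>.\<close>

lemma powr_mat_jordan_block:
  assumes "i < n" "j < n"
  shows "powr_mat x (jordan_block n 0) $$ (i, j) = (if i \<le> j then ln x ^ (j - i) / fact (j - i) else 0)"
proof -
  let ?s = "\<lambda>k. ((ln x \<cdot>\<^sub>m jordan_block n 0) ^\<^sub>m k) $$ (i, j) / fact k"
  have s: "?s k = (if i \<le> j \<and> k = j - i then ln x ^ (j - i) / fact (j - i) else 0)" for k
    using assms by (auto simp: pow_smult_mat[of _ n] jordan_block_zero_pow)
  have "(\<Sum>k. ?s k) = (if i \<le> j then ln x ^ (j - i) / fact (j - i) else 0)"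
  proof (cases "i \<le> j")
    case True
    have "?s = (\<lambda>k. if k = j - i then ln x ^ (j - i) / fact (j - i) else 0)"
      using s True by auto
    then have "?s sums (ln x ^ (j - i) / fact (j - i))"
      using sums_single[of "j - i" "\<lambda>_. ln x ^ (j - i) / fact (j - i)"] by simp
    then show ?thesis using True by (simp add: sums_iff)
  next
    case False
    then show ?thesis using s by simp
  qed
  then show ?thesis using assms by (simp add: powr_mat_def mat_exp_def)
qed

text \<open>Row 0 suffices because the index \<open>c\<close> is the first unit vector. The
  integrand has the antiderivative \<open>ln y ^ Suc j / fact (Suc j)\<close>, which vanishes at
  1.\<close>

lemma powr_mat_integral_jordan_block:
  assumes "j < n" "x > 0"
  shows "powr_mat_integral x (jordan_block n 0) $$ (0, j) = ln x ^ Suc j / fact (Suc j)"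
proof -
  have "powr_mat_integral x (jordan_block n 0) $$ (0, j) =
      (LBINT y=ereal 1..ereal x. powr_mat y (jordan_block n 0) $$ (0, j) / y)"
    using assms by (simp add: powr_mat_integral_def)
  also have "\<dots> = (LBINT y=ereal 1..ereal x. ln y ^ j / fact j / y)"
    using assms by (simp add: powr_mat_jordan_block)
  also have "\<dots> = ln x ^ Suc j / fact (Suc j) - ln 1 ^ Suc j / fact (Suc j)"
  proof (rule interval_integral_FTC_finite)
    have pos: "y > 0" if "y \<ge> min 1 x" for y
      using that assms(2) by (auto simp: min_def split: if_splits)
    show "continuous_on {min 1 x..max 1 x} (\<lambda>y. ln y ^ j / fact j / y)"
      by (intro continuous_intros) (use pos in fastforce)+
    fix y assume "min 1 x \<le> y" "y \<le> max 1 x"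
    then have y: "y > 0" using pos by blast
    have "((\<lambda>y. ln y ^ Suc j / fact (Suc j)) has_real_derivative ln y ^ j / fact j / y) (at y)"
    proof -
      have "((\<lambda>y. ln y ^ Suc j / fact (Suc j)) has_real_derivative
          real (Suc j) * ln y ^ j * (1 / y) / fact (Suc j)) (at y)"
        by (rule derivative_eq_intros refl | use y in simp)+
      moreover have "real (Suc j) * ln y ^ j * (1 / y) / fact (Suc j) = ln y ^ j / fact j / y"
        using y by (simp add: field_simps del: of_nat_Suc)
      ultimately show ?thesis by (simp only:)
    qed
    then show "((\<lambda>y. ln y ^ Suc j / fact (Suc j)) has_vector_derivative ln y ^ j / fact j / y)
        (at y within {min 1 x..max 1 x})"
      by (simp add: has_real_derivative_iff_has_vector_derivative has_vector_derivative_at_within)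
  qed
  finally show ?thesis by simp
qed

text \<open>With \<open>g j = L (Suc j) t\<close> this is the Taylor polynomial of
  \<open>L 0\<close> in logarithmic scale without its constant term, which links the class \<Pi> to
  \<open>log_taylor_smallo\<close>.\<close>

lemma Pi_h_jordan_block:
  assumes "n \<ge> 1" "x > 0"
  shows "Pi_h (unit_vec n 0) (jordan_block n 0) x \<bullet> vec n g = (\<Sum>j<n. ln x ^ Suc j / fact (Suc j) * g j)"
proof -
  let ?M = "powr_mat_integral x (jordan_block n 0)"
  have dim: "?M \<in> carrier_mat n n" by (simp add: powr_mat_integral_def carrier_matI)
  have "(transpose_mat ?M *\<^sub>v unit_vec n 0) $ j = ln x ^ Suc j / fact (Suc j)" if "j < n" for j
  proof -
    have "(transpose_mat ?M *\<^sub>v unit_vec n 0) $ j = row (transpose_mat ?M) j \<bullet> unit_vec n 0"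
      using dim that by simp
    also have "\<dots> = row (transpose_mat ?M) j $ 0"
      using dim that assms by (intro scalar_prod_right_unit) auto
    also have "\<dots> = ?M $$ (0, j)" using dim that assms by simp
    finally show ?thesis using powr_mat_integral_jordan_block that assms by simp
  qed
  then show ?thesis
    by (simp add: Pi_h_def scalar_prod_def lessThan_atLeast0)
qed

text \<open>With \<open>g j = L (Suc j) t\<close> this is the Taylor polynomial of
  \<open>L (Suc i)\<close>, whose last term involves \<open>L n\<close>.\<close>

lemma powr_mat_jordan_block_mult_vec:
  assumes "i < n"
  shows "(powr_mat x (jordan_block n 0) *\<^sub>v vec n g) $ i =
    (\<Sum>j\<le>n - Suc i. ln x ^ j / fact j * g (i + j))"
proof -
  let ?M = "powr_mat x (jordan_block n 0)"
  have dim: "dim_row ?M = n" "dim_col ?M = n" by (simp_all add: powr_mat_def mat_exp_def)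
  have "(?M *\<^sub>v vec n g) $ i = (\<Sum>j\<in>{0..<n}. ?M $$ (i, j) * g j)"
    using assms dim by (simp add: scalar_prod_def)
  also have "\<dots> = (\<Sum>j\<in>{0..<n}. if i \<le> j then ln x ^ (j - i) / fact (j - i) * g j else 0)"
    using assms by (intro sum.cong) (auto simp: powr_mat_jordan_block)
  also have "\<dots> = (\<Sum>j\<in>{i..<n}. ln x ^ (j - i) / fact (j - i) * g j)"
    by (intro sum.mono_neutral_cong_right) auto
  also have "\<dots> = (\<Sum>j\<le>n - Suc i. ln x ^ j / fact j * g (i + j))"
    by (rule sum.reindex_bij_witness[of _ "\<lambda>j. i + j" "\<lambda>j. j - i"]) (use assms in auto)
  finally show ?thesis .
qed

text \<open>No eigenvalue other than 0 exists, so none lies above another and the condition on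
  geometric multiplicities is vacuous.\<close>

lemma index_matrix_jordan_block: "index_matrix n (jordan_block n 0)"
proof -
  have "ev = 0" if "eigenvalue (jordan_block n 0) ev" for ev :: real
    using that by (auto simp: eigenvalue_root_char_poly[of _ n] jordan_block_char_poly)
  then show ?thesis
    unfolding index_matrix_def by (auto simp: upper_triangular_def)
qed

subsection \<open>Iterated differentiability relative to a domain\<close>

lemma has_real_derivative_deriv_on:
  "F differentiable (at t within S) \<Longrightarrow> (F has_real_derivative deriv_on S F t) (at t within S)"
  by (simp add: deriv_on_def has_real_derivative_iff_has_vector_derivative vector_derivative_works)

lemma deriv_on_eqI:
  "at t within S \<noteq> bot \<Longrightarrow> (F has_real_derivative D) (at t within S) \<Longrightarrow> deriv_on S F t = D"
  by (simp add: deriv_on_def has_real_derivative_iff_has_vector_derivative vector_derivative_within)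

lemma deriv_on_cong:
  assumes "\<And>s. s \<in> S \<Longrightarrow> F s = G s" "t \<in> S"
  shows "deriv_on S F t = deriv_on S G t"
proof -
  have "(F has_vector_derivative D) (at t within S) \<longleftrightarrow> (G has_vector_derivative D) (at t within S)" for D
    using has_vector_derivative_transform[OF assms(2), of F G D] has_vector_derivative_transform[OF assms(2), of G F D]
      assms(1) by metis
  then show ?thesis by (simp add: deriv_on_def vector_derivative_def)
qed

text \<open>Peels off the innermost derivative, the form suited to induction with \<open>F\<close>
  arbitrary.\<close>

lemma times_cont_differentiable_on_Suc:
  "times_cont_differentiable_on (Suc k) S F \<longleftrightarrow>
     F differentiable_on S \<and> times_cont_differentiable_on k S (deriv_on S F)"
  unfolding times_cont_differentiable_on_def All_less_Suc2 by (auto simp: funpow_Suc_right simp del: funpow.simps(2))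

lemma times_cont_differentiable_on_cong:
  assumes "\<And>t. t \<in> S \<Longrightarrow> F t = G t" "times_cont_differentiable_on k S F"
  shows "times_cont_differentiable_on k S G"
  using assms
proof (induction k arbitrary: F G)
  case 0
  then show ?case by (auto simp: times_cont_differentiable_on_def cong: continuous_on_cong)
next
  case (Suc k)
  have "G differentiable_on S"
    using Suc.prems differentiable_transform_within[of F _ S 1 G]
    by (auto simp: times_cont_differentiable_on_Suc differentiable_on_def)
  moreover have "times_cont_differentiable_on k S (deriv_on S G)"
    using Suc.IH[of "deriv_on S F" "deriv_on S G"] deriv_on_cong[of S F G] Suc.prems
    by (simp add: times_cont_differentiable_on_Suc)
  ultimately show ?case by (simp add: times_cont_differentiable_on_Suc)
qed

lemma times_cont_differentiable_on_SucD:
  "times_cont_differentiable_on (Suc k) S F \<Longrightarrow> times_cont_differentiable_on k S F"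
  unfolding times_cont_differentiable_on_def by (auto intro: differentiable_imp_continuous_on)

lemma times_cont_differentiable_on_mono:
  assumes "times_cont_differentiable_on k S F" "j \<le> k"
  shows "times_cont_differentiable_on j S F"
  using assms(2,1) by (induction rule: dec_induct) (auto dest: times_cont_differentiable_on_SucD)

lemma times_cont_differentiable_on_continuous:
  "times_cont_differentiable_on k S F \<Longrightarrow> continuous_on S F"
  using times_cont_differentiable_on_mono[of k S F 0] by (simp add: times_cont_differentiable_on_def)

text \<open>Without isolated points derivatives relative to \<open>S\<close> are unique, so
  \<open>deriv_on\<close> is additive on differentiable functions.\<close>

lemma times_cont_differentiable_on_add:
  assumes perfect: "\<And>t. t \<in> S \<Longrightarrow> at t within S \<noteq> bot"
  shows "times_cont_differentiable_on k S F \<Longrightarrow> times_cont_differentiable_on k S G \<Longrightarrow>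
    times_cont_differentiable_on k S (\<lambda>t. F t + G t)"
proof (induction k arbitrary: F G)
  case 0
  then show ?case by (auto simp: times_cont_differentiable_on_def intro: continuous_on_add)
next
  case (Suc k)
  then have diff: "F differentiable_on S" "G differentiable_on S"
    by (auto simp: times_cont_differentiable_on_Suc)
  have eq: "deriv_on S F t + deriv_on S G t = deriv_on S (\<lambda>t. F t + G t) t" if "t \<in> S" for t
    using that diff unfolding differentiable_on_def
    by (intro deriv_on_eqI[symmetric] perfect DERIV_add has_real_derivative_deriv_on) auto
  have "times_cont_differentiable_on k S (\<lambda>t. deriv_on S F t + deriv_on S G t)"
    using Suc by (simp add: times_cont_differentiable_on_Suc)
  from times_cont_differentiable_on_cong[OF eq this] show ?case
    using diff by (simp add: times_cont_differentiable_on_Suc)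
qed

lemma times_cont_differentiable_on_mult:
  assumes perfect: "\<And>t. t \<in> S \<Longrightarrow> at t within S \<noteq> bot"
  shows "times_cont_differentiable_on k S F \<Longrightarrow> times_cont_differentiable_on k S G \<Longrightarrow>
    times_cont_differentiable_on k S (\<lambda>t. F t * G t)"
proof (induction k arbitrary: F G)
  case 0
  then show ?case by (auto simp: times_cont_differentiable_on_def intro: continuous_on_mult)
next
  case (Suc k)
  then have diff: "F differentiable_on S" "G differentiable_on S"
    by (auto simp: times_cont_differentiable_on_Suc)
  have eq: "deriv_on S F t * G t + deriv_on S G t * F t = deriv_on S (\<lambda>t. F t * G t) t" if "t \<in> S" for t
    using that diff unfolding differentiable_on_def
    by (intro deriv_on_eqI[symmetric] perfect DERIV_mult has_real_derivative_deriv_on) auto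
  have "times_cont_differentiable_on k S (\<lambda>t. deriv_on S F t * G t + deriv_on S G t * F t)"
    using Suc.prems times_cont_differentiable_on_SucD[of k S]
    by (intro times_cont_differentiable_on_add perfect Suc.IH) (auto simp: times_cont_differentiable_on_Suc)
  from times_cont_differentiable_on_cong[OF eq this] show ?case
    using diff by (simp add: times_cont_differentiable_on_Suc differentiable_on_mult)
qed

subsection \<open>The inverse of \<open>A\<close>\<close>

text \<open>The difference quotient of \<open>g\<close> at \<open>z\<close> is the reciprocal of
  that of \<open>A\<close> at \<open>g z\<close>. The argument works relative to any
  \<open>S\<close>, so it covers the endpoint of a ray as well.\<close>

lemma has_real_derivative_inverse_within:
  fixes A g :: "real \<Rightarrow> real"
  assumes der: "(A has_real_derivative a) (at s within S)" and a: "a \<noteq> 0" and s: "s \<in> S"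
    and inv: "\<And>r. r \<in> S \<Longrightarrow> g (A r) = r" and cont: "(g \<longlongrightarrow> s) (at (A s) within A ` S)"
  shows "(g has_real_derivative inverse a) (at (A s) within A ` S)"
proof -
  have "((\<lambda>r. (A r - A s) / (r - s)) \<longlongrightarrow> a) (at s within S)"
    using der by (simp add: has_field_derivative_iff)
  moreover have g: "eventually (\<lambda>z. g z \<in> S \<and> A (g z) = z \<and> g z \<noteq> s) (at (A s) within A ` S)"
    unfolding eventually_at_filter using inv by (auto intro!: always_eventually)
  then have "filterlim g (at s within S) (at (A s) within A ` S)"
    using cont by (auto simp: filterlim_at elim: eventually_mono)
  ultimately have "((\<lambda>z. (A (g z) - A s) / (g z - s)) \<longlongrightarrow> a) (at (A s) within A ` S)"
    by (rule filterlim_compose)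
  then have "((\<lambda>z. inverse ((A (g z) - A s) / (g z - s))) \<longlongrightarrow> inverse a) (at (A s) within A ` S)"
    by (rule tendsto_inverse[OF _ a])
  then have "((\<lambda>z. (g z - g (A s)) / (z - A s)) \<longlongrightarrow> inverse a) (at (A s) within A ` S)"
    by (rule Lim_transform_eventually) (use g s in \<open>auto elim!: eventually_mono simp: inv\<close>)
  then show ?thesis by (simp add: has_field_derivative_iff)
qed

text \<open>The inverse is continuous on the image of the compact set \<open>{a..s + 1}\<close>, and
  by monotonicity this image agrees with the full one near \<open>A s\<close>.\<close>

lemma tendsto_inverse_strict_mono_within:
  fixes A g :: "real \<Rightarrow> real"
  assumes mono: "\<And>r s. a \<le> r \<Longrightarrow> r < s \<Longrightarrow> A r < A s" and cont: "continuous_on {a..} A"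
    and inv: "\<And>r. r \<ge> a \<Longrightarrow> g (A r) = r" and s: "s \<ge> a"
  shows "(g \<longlongrightarrow> s) (at (A s) within A ` {a..})"
proof -
  have "continuous_on (A ` {a..s + 1}) g"
    by (rule continuous_on_inv) (use cont inv in \<open>auto intro: continuous_on_subset\<close>)
  then have "(g \<longlongrightarrow> g (A s)) (at (A s) within A ` {a..s + 1})"
    using s by (auto simp: continuous_on_def)
  moreover have "at (A s) within A ` {a..s + 1} = at (A s) within A ` {a..}"
  proof (rule at_within_nhd[where S = "{..<A (s + 1)}"])
    have "r \<le> s + 1" if "a \<le> r" "A r < A (s + 1)" for r
      using mono[of "s + 1" r] that s by (cases "r \<le> s + 1") auto
    then show "A ` {a..s + 1} \<inter> {..<A (s + 1)} - {A s} = A ` {a..} \<inter> {..<A (s + 1)} - {A s}" by auto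
  qed (use mono s in auto)
  ultimately show ?thesis using inv s by simp
qed

text \<open>The image is connected and has at least two points, hence no isolated point.\<close>

lemma at_within_strict_mono_image_neq_bot:
  fixes A :: "real \<Rightarrow> real"
  assumes mono: "\<And>r s. a \<le> r \<Longrightarrow> r < s \<Longrightarrow> A r < A s" and cont: "continuous_on {a..} A" and s: "s \<ge> a"
  shows "at (A s) within A ` {a..} \<noteq> bot"
proof -
  have "connected (A ` {a..})" by (rule connected_continuous_image[OF cont]) auto
  moreover have "A ` {a..} \<noteq> {x}" for x
  proof
    assume "A ` {a..} = {x}"
    moreover have "A s \<in> A ` {a..}" "A (s + 1) \<in> A ` {a..}" using s by auto
    ultimately show False using mono[of s "s + 1"] s by simp
  qed
  ultimately have "A s islimpt A ` {a..}"
    using s by (intro connected_imp_perfect) auto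
  then show ?thesis by (simp add: trivial_limit_within)
qed

lemma at_within_atLeast_neq_bot: "t \<ge> a \<Longrightarrow> at t within {a..} \<noteq> bot" for t :: real
  using at_within_strict_mono_image_neq_bot[of a "\<lambda>x. x" t] by simp

text \<open>The domain of \<open>f\<close> is kept as an image because \<open>A\<close> is bounded
  when \<open>1 / q\<close> is integrable; it is identified with a ray only once \<open>q\<close> is
  known to be small against the identity.\<close>

locale exponential_inverse =
  fixes t0 :: real and q A f :: "real \<Rightarrow> real"
  assumes q_cont: "continuous_on {t0..} q"
    and q_pos: "\<And>t. t \<ge> t0 \<Longrightarrow> q t > 0"
    and A_pos: "\<And>t. t \<ge> t0 \<Longrightarrow> A t > 0"
    and A_eq: "\<And>t. t \<ge> t0 \<Longrightarrow> A t = A t0 * exp (integral {t0..t} (\<lambda>s. 1 / q s))"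
    and f_eq: "\<And>y. y \<in> A ` {t0..} \<Longrightarrow> f y = inv_into {t0..} A y"
begin

lemma A_deriv:
  assumes "t \<ge> t0"
  shows "(A has_real_derivative A t / q t) (at t within {t0..})"
proof -
  have "continuous_on {t0..t + 1} (\<lambda>s. 1 / q s)"
    using q_pos by (intro continuous_intros continuous_on_subset[OF q_cont]) force+
  then have "((\<lambda>x. integral {t0..x} (\<lambda>s. 1 / q s)) has_real_derivative 1 / q t) (at t within {t0..t + 1})"
    by (rule integral_has_real_derivative) (use assms in auto)
  \<comment> \<open>Near \<open>t\<close>, also if \<open>t = t0\<close>, the compact interval of
    the fundamental theorem and the ray coincide.\<close>
  moreover have "at t within {t0..t + 1} = at t within {t0..}"
    by (rule at_within_nhd[where S = "{..<t + 1}"]) auto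
  ultimately have "((\<lambda>x. integral {t0..x} (\<lambda>s. 1 / q s)) has_real_derivative 1 / q t) (at t within {t0..})"
    by simp
  then have "((\<lambda>x. A t0 * exp (integral {t0..x} (\<lambda>s. 1 / q s))) has_real_derivative
      A t0 * (exp (integral {t0..t} (\<lambda>s. 1 / q s)) * (1 / q t))) (at t within {t0..})"
    by (auto intro!: derivative_eq_intros)
  then have "((\<lambda>x. A t0 * exp (integral {t0..x} (\<lambda>s. 1 / q s))) has_real_derivative A t / q t) (at t within {t0..})"
    using A_eq[OF assms] by simp
  then show ?thesis
    by (rule has_field_derivative_transform_within[of _ _ _ _ 1]) (use assms in \<open>auto simp: A_eq[symmetric]\<close>)
qed

lemma A_cont: "continuous_on {t0..} A"
  using A_deriv by (intro DERIV_continuous_on) auto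

lemma A_deriv_at:
  assumes "t > t0"
  shows "(A has_real_derivative A t / q t) (at t)"
proof -
  have "at t within {t0..} = at t"
    by (rule at_within_open_subset[of t "{t0<..}"]) (use assms in auto)
  then show ?thesis using A_deriv[of t] assms by simp
qed

lemma A_strict_mono:
  assumes "t0 \<le> r" "r < s"
  shows "A r < A s"
proof (rule DERIV_pos_imp_increasing_open[OF assms(2)])
  fix x assume "r < x" "x < s"
  then show "\<exists>y. (A has_real_derivative y) (at x) \<and> y > 0"
    using A_deriv_at[of x] A_pos[of x] q_pos[of x] assms by (intro exI[of _ "A x / q x"]) auto
qed (use assms in \<open>auto intro: continuous_on_subset[OF A_cont]\<close>)

lemma A_inj: "inj_on A {t0..}"
  by (rule linorder_inj_onI) (use A_strict_mono in \<open>auto simp: less_imp_neq\<close>)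

lemma at_within_image_neq_bot: "y \<in> A ` {t0..} \<Longrightarrow> at y within A ` {t0..} \<noteq> bot"
  using at_within_strict_mono_image_neq_bot[OF A_strict_mono A_cont] by auto

lemma f_A: "r \<ge> t0 \<Longrightarrow> f (A r) = r"
  using f_eq A_inj by simp

lemma A_f: "y \<in> A ` {t0..} \<Longrightarrow> A (f y) = y"
  using f_A by auto

lemma f_ge: "y \<in> A ` {t0..} \<Longrightarrow> f y \<ge> t0"
  using f_A by auto

lemma f_deriv:
  assumes "y \<in> A ` {t0..}"
  shows "(f has_real_derivative q (f y) / y) (at y within A ` {t0..})"
proof -
  obtain s where s: "s \<ge> t0" "y = A s" using assms by auto
  have "(f has_real_derivative inverse (A s / q s)) (at (A s) within A ` {t0..})"
  proof (rule has_real_derivative_inverse_within[OF A_deriv])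
    show "(f \<longlongrightarrow> s) (at (A s) within A ` {t0..})"
      by (rule tendsto_inverse_strict_mono_within[OF A_strict_mono A_cont f_A s(1)])
  qed (use s A_pos[of s] q_pos[of s] f_A in auto)
  then show ?thesis using s f_A by simp
qed

lemma compose_f_deriv:
  assumes "y \<in> A ` {t0..}" "F differentiable_on {t0..}"
  shows "((\<lambda>y. F (f y)) has_real_derivative q (f y) * deriv_on {t0..} F (f y) / y) (at y within A ` {t0..})"
proof -
  have "(F has_real_derivative deriv_on {t0..} F (f y)) (at (f y) within {t0..})"
    using assms(2) f_ge[OF assms(1)] by (intro has_real_derivative_deriv_on) (auto simp: differentiable_on_def)
  moreover have "f ` A ` {t0..} = {t0..}" using f_A by (force simp: image_image)
  ultimately have "(F \<circ> f has_real_derivative deriv_on {t0..} F (f y) * (q (f y) / y)) (at y within A ` {t0..})"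
    by (intro DERIV_image_chain f_deriv assms) simp
  then show ?thesis by (simp add: o_def mult.commute)
qed

end

section \<open>Iterated logarithmic derivatives of the inverse\<close>

locale iterated_log_derivatives = exponential_inverse +
  fixes n :: nat and L qs :: "nat \<Rightarrow> real \<Rightarrow> real"
  assumes n: "n \<ge> 1"
    and q_diff: "times_cont_differentiable_on (n - 1) {t0..} q"
    and L_0: "\<And>y. y \<in> A ` {t0..} \<Longrightarrow> L 0 y = f y"
    and L_step: "\<And>i y. i \<in> {1..n} \<Longrightarrow> y \<in> A ` {t0..} \<Longrightarrow> L i y = y * deriv_on (A ` {t0..}) (L (i - 1)) y"
    and q_1: "\<And>t. t \<ge> t0 \<Longrightarrow> qs 1 t = q t"
    and q_step: "\<And>i t. i \<in> {2..n} \<Longrightarrow> t \<ge> t0 \<Longrightarrow> qs i t = q t * deriv_on {t0..} (qs (i - 1)) t"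
begin

text \<open>Each passage to the next function costs one derivative of \<open>q\<close>, which starts
  with \<open>n - 1\<close>.\<close>

lemma qs_times_cont_differentiable:
  assumes "1 \<le> i" "i \<le> n"
  shows "times_cont_differentiable_on (n - i) {t0..} (qs i)"
  using assms
proof (induction i rule: dec_induct)
  case base
  then show ?case using times_cont_differentiable_on_cong[OF _ q_diff, of "qs 1"] q_1 by simp
next
  case (step i)
  then have "n - i = Suc (n - Suc i)" by simp
  then have "times_cont_differentiable_on (n - Suc i) {t0..} (deriv_on {t0..} (qs i))"
    using step by (simp add: times_cont_differentiable_on_Suc)
  moreover have "times_cont_differentiable_on (n - Suc i) {t0..} q"
    by (rule times_cont_differentiable_on_mono[OF q_diff]) (use step in simp)
  ultimately have "times_cont_differentiable_on (n - Suc i) {t0..} (\<lambda>t. q t * deriv_on {t0..} (qs i) t)"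
    by (intro times_cont_differentiable_on_mult at_within_atLeast_neq_bot) auto
  then show ?case
    by (rule times_cont_differentiable_on_cong[rotated]) (use q_step[of "Suc i"] step in auto)
qed

lemma qs_differentiable:
  assumes "1 \<le> i" "i < n"
  shows "qs i differentiable_on {t0..}"
proof -
  have "n - i = Suc (n - Suc i)" using assms by simp
  then show ?thesis
    using qs_times_cont_differentiable[of i] assms by (simp add: times_cont_differentiable_on_Suc)
qed

text \<open>Both claims go through one induction: the derivative of \<open>L i\<close> identifies
  \<open>L (Suc i)\<close>, and this identity yields its derivative by the chain rule. The range
  \<open>i < n\<close> leaves out \<open>L n\<close>, for which no derivative is claimed.\<close>

lemma L_eq_and_deriv:
  assumes "i < n"
  shows "(i \<ge> 1 \<longrightarrow> (\<forall>y\<in>A ` {t0..}. L i y = qs i (f y))) \<and>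
    (\<forall>y\<in>A ` {t0..}. (L i has_real_derivative qs (Suc i) (f y) / y) (at y within A ` {t0..}))"
  using assms
proof (induction i)
  case 0
  have "(L 0 has_real_derivative qs (Suc 0) (f y) / y) (at y within A ` {t0..})" if "y \<in> A ` {t0..}" for y
  proof (rule has_field_derivative_transform_within[where d = 1])
    show "(f has_real_derivative qs (Suc 0) (f y) / y) (at y within A ` {t0..})"
      using f_deriv[OF that] q_1[OF f_ge[OF that]] by simp
  qed (use that L_0 in auto)
  then show ?case by simp
next
  case (Suc i)
  have eq: "L (Suc i) y = qs (Suc i) (f y)" if "y \<in> A ` {t0..}" for y
  proof -
    have "deriv_on (A ` {t0..}) (L i) y = qs (Suc i) (f y) / y"
      using Suc that by (intro deriv_on_eqI at_within_image_neq_bot) auto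
    moreover have "y > 0" using that A_pos by auto
    ultimately show ?thesis using L_step[of "Suc i" y] that Suc.prems by simp
  qed
  have "(L (Suc i) has_real_derivative qs (Suc (Suc i)) (f y) / y) (at y within A ` {t0..})"
    if y: "y \<in> A ` {t0..}" for y
  proof -
    have "((\<lambda>y. qs (Suc i) (f y)) has_real_derivative qs (Suc (Suc i)) (f y) / y) (at y within A ` {t0..})"
      using compose_f_deriv[OF y qs_differentiable[of "Suc i"]] q_step[of "Suc (Suc i)" "f y"] f_ge[OF y]
        Suc.prems by simp
    then show ?thesis
      by (rule has_field_derivative_transform_within[where d = 1]) (use eq y in auto)
  qed
  then show ?case using eq by blast
qed

lemma L_deriv:
  "i < n \<Longrightarrow> y \<in> A ` {t0..} \<Longrightarrow> (L i has_real_derivative qs (Suc i) (f y) / y) (at y within A ` {t0..})"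
  using L_eq_and_deriv by blast

lemma L_eq:
  assumes "1 \<le> i" "i \<le> n" "y \<in> A ` {t0..}"
  shows "L i y = qs i (f y)"
proof -
  have "deriv_on (A ` {t0..}) (L (i - 1)) y = qs i (f y) / y"
    using L_deriv[of "i - 1" y] assms by (intro deriv_on_eqI at_within_image_neq_bot) auto
  moreover have "y > 0" using assms(3) A_pos by auto
  ultimately show ?thesis using L_step[of i y] assms by simp
qed

lemma at_within_S: "t > t0 \<Longrightarrow> at t within {t0..} = at t"
  by (rule at_within_open_subset[of t "{t0<..}"]) auto

lemma iterated_deriv_at:
  assumes "k < n - 1" "t > t0"
  shows "((deriv_on {t0..} ^^ k) q has_real_derivative (deriv_on {t0..} ^^ Suc k) q t) (at t)"
proof -
  have "(deriv_on {t0..} ^^ k) q differentiable (at t within {t0..})"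
    using q_diff assms by (auto simp: times_cont_differentiable_on_def differentiable_on_def)
  from has_real_derivative_deriv_on[OF this] show ?thesis using assms by (simp add: at_within_S)
qed

text \<open>Applies \<open>iterated_rates\<close> with \<open>N = n - 1\<close>, so that the index
  \<open>\<alpha> - real n + 1\<close> is \<open>\<alpha> - real N\<close> and the excluded orders
  are those from 2 to \<open>N\<close>.\<close>

lemma qs_rates:
  assumes Dq: "(deriv_on {t0..} q \<longlongrightarrow> 0) at_top"
    and sign: "eventually_const_sign ((deriv_on {t0..} ^^ (n - 1)) q)"
    and rv: "regularly_varying {t0..} (\<lambda>t. \<bar>(deriv_on {t0..} ^^ (n - 1)) q t\<bar>) (\<alpha> - real n + 1)"
    and \<alpha>: "\<not> (\<exists>m\<in>{2..n - 1}. \<alpha> = (real m - 1) / real m)"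
  shows "(\<forall>i\<in>{1..n}. eventually_const_sign (qs i)) \<and>
    (\<forall>i\<in>{1..<n}. ((\<lambda>t. qs (Suc i) t / qs i t) \<longlongrightarrow> 0) at_top) \<and> slowly_oscillating (qs n)"
proof -
  define d where "d = (\<lambda>k. (deriv_on {t0..} ^^ k) q)"
  define N where "N = n - 1"
  have nN: "n = Suc N" using n by (simp add: N_def)
  have gt: "eventually (\<lambda>t. t > t0) at_top" by (rule eventually_gt_at_top)
  have d0: "d 0 = q" and d1: "d 1 = deriv_on {t0..} q" by (simp_all add: d_def)
  have der: "eventually (\<lambda>t. (d k has_real_derivative d (Suc k) t) (at t)) at_top" if "k < N" for k
    using gt by eventually_elim (use iterated_deriv_at that in \<open>auto simp: d_def N_def\<close>)
  have signN: "eventually_const_sign (d N)" using sign by (simp add: d_def N_def)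
  have rvN: "rv (d N) (\<alpha> - real N)"
    unfolding rv_def
  proof (intro conjI allI impI signN)
    have "continuous_on {t0..} (d N)"
      using q_diff by (simp add: times_cont_differentiable_on_def d_def N_def)
    then have cont: "continuous (at t within {t0..}) (d N)" if "t > t0" for t
      using that by (simp add: continuous_on_eq_continuous_within)
    show "eventually (isCont (d N)) at_top"
      using gt
    proof eventually_elim
      case (elim t)
      then show ?case using cont[OF elim] at_within_S[OF elim] by simp
    qed
    fix x :: real assume x: "x > 0"
    have l: "((\<lambda>t. \<bar>d N (x * t)\<bar> / \<bar>d N t\<bar>) \<longlongrightarrow> x powr (\<alpha> - real N)) at_top"
    proof -
      have "\<alpha> - real n + 1 = \<alpha> - real N" by (simp add: nN)
      then show ?thesis using rv x by (simp only: regularly_varying_def d_def N_def)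
    qed
    \<comment> \<open>Constant sign at both \<open>t\<close> and \<open>x * t\<close> lets the
      absolute values be dropped from the quotient.\<close>
    have "eventually (\<lambda>t. \<bar>d N (x * t)\<bar> / \<bar>d N t\<bar> = d N (x * t) / d N t) at_top"
      using signN unfolding eventually_const_sign_def
    proof
      assume p: "eventually (\<lambda>t. d N t > 0) at_top"
      show ?thesis using p eventually_scaled_at_top[OF p x] by eventually_elim simp
    next
      assume p: "eventually (\<lambda>t. d N t < 0) at_top"
      show ?thesis using p eventually_scaled_at_top[OF p x] by eventually_elim simp
    qed
    with l show "((\<lambda>t. d N (x * t) / d N t) \<longlongrightarrow> x powr (\<alpha> - real N)) at_top"
      by (rule Lim_transform_eventually)
  qed
  have pos: "eventually (\<lambda>t. d 0 t > 0) at_top"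
    using gt by eventually_elim (use q_pos in \<open>simp add: d0\<close>)
  have Q1: "eventually (\<lambda>t. qs 1 t = d 0 t) at_top"
    using gt by eventually_elim (use q_1 in \<open>simp add: d0\<close>)
  show ?thesis
  proof (cases "N = 0")
    case True
    \<comment> \<open>For \<open>n = 1\<close> nothing is iterated: \<open>qs 1\<close> is
      \<open>q\<close> itself, whose sign and regular variation are given.\<close>
    have Q1': "eventually (\<lambda>t. d 0 t = qs 1 t) at_top" using Q1 by eventually_elim simp
    have "eventually_const_sign (qs 1)"
      by (rule eventually_const_sign_cong[OF _ Q1']) (use signN True in simp)
    moreover have "slowly_oscillating (qs 1)"
      by (rule slowly_oscillating_cong[OF _ Q1']) (use rv_slowly_oscillating[OF rvN] True in simp)
    ultimately show ?thesis using True by (simp add: nN)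
  next
    case False
    have "(\<forall>i\<in>{1..Suc N}. eventually_const_sign (qs i)) \<and>
      (\<forall>i\<in>{1..N}. ((\<lambda>t. qs (Suc i) t / qs i t) \<longlongrightarrow> 0) at_top) \<and> slowly_oscillating (qs (Suc N))"
    proof (rule iterated_rates[where d = d and \<alpha> = \<alpha> and Q' = "\<lambda>i. deriv_on {t0..} (qs i)"])
      fix i assume i: "i \<in> {1..N}"
      show "eventually (\<lambda>t. (qs i has_real_derivative deriv_on {t0..} (qs i) t) (at t)) at_top"
        using gt
      proof eventually_elim
        case (elim t)
        have "qs i differentiable (at t within {t0..})"
          using qs_differentiable[of i] i elim by (auto simp: differentiable_on_def nN)
        from has_real_derivative_deriv_on[OF this] show ?case using elim by (simp add: at_within_S)
      qed
      show "eventually (\<lambda>t. qs (Suc i) t = d 0 t * deriv_on {t0..} (qs i) t) at_top"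
        using gt by eventually_elim (use q_step[of "Suc i"] i in \<open>auto simp: nN d0\<close>)
    qed (use False der Dq d1 rvN pos Q1 \<alpha> in \<open>auto simp: N_def\<close>)
    then show ?thesis by (auto simp: nN)
  qed
qed

section \<open>Asymptotics of the inverse and its logarithmic derivatives\<close>

lemma Pi_class_f:
  assumes diff: "eventually (\<lambda>t. q differentiable (at t)) at_top"
    and Dq: "deriv_on {t0..} q \<in> o[at_top](\<lambda>t. 1)"
    and sign: "eventually_const_sign ((deriv_on {t0..} ^^ (n - 1)) q)"
    and rv: "regularly_varying {t0..} (\<lambda>t. \<bar>(deriv_on {t0..} ^^ (n - 1)) q t\<bar>) (\<alpha> - real n + 1)"
    and \<alpha>: "\<not> (\<exists>m\<in>{2..n - 1}. \<alpha> = (real m - 1) / real m)"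
  shows "eventually_const_sign (L n)" "slowly_varying (A ` {t0..}) (\<lambda>y. \<bar>L n y\<bar>)"
    "Pi_class n (A ` {t0..}) f (A ` {t0..}) (\<lambda>y. vec n (\<lambda>i. L (Suc i) y)) (jordan_block n 0) (unit_vec n 0)"
proof -
  have gt: "eventually (\<lambda>t. t > t0) at_top" by (rule eventually_gt_at_top)
  have Dq0: "(deriv_on {t0..} q \<longlongrightarrow> 0) at_top" using smalloD_tendsto[OF Dq] by simp
  \<comment> \<open>For \<open>n = 1\<close> the smoothness assumption is mere continuity, so
    differentiability of \<open>q\<close> near infinity comes from \<open>diff\<close>.\<close>
  have "eventually (\<lambda>t. (q has_real_derivative deriv_on {t0..} q t) (at t)) at_top"
    using diff gt
  proof eventually_elim
    case (elim t)
    then show ?case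
      using has_real_derivative_deriv_on[of q t "{t0..}"] at_within_S[of t] by simp
  qed
  then have q_small: "((\<lambda>t. q t / t) \<longlongrightarrow> 0) at_top" using Dq0 by (rule tendsto_ratio_zero_of_deriv)
  have derA: "eventually (\<lambda>t. (A has_real_derivative A t / q t) (at t)) at_top"
    using gt by eventually_elim (rule A_deriv_at)
  have posA: "eventually (\<lambda>t. A t > 0) at_top" using gt by eventually_elim (simp add: A_pos)
  have posq: "eventually (\<lambda>t. q t > 0) at_top" using gt by eventually_elim (simp add: q_pos)
  have A_top: "filterlim A at_top at_top" by (rule rapid_growth_at_top[OF derA posA posq q_small])
  \<comment> \<open>\<open>A\<close> is continuous, increasing and now known to be unbounded, so its
    image is the full ray from \<open>A t0\<close>.\<close>
  have range: "A ` {t0..} = {A t0..}"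
  proof (intro equalityI subsetI)
    fix y assume "y \<in> A ` {t0..}"
    then obtain s where s: "s \<ge> t0" "y = A s" by auto
    then show "y \<in> {A t0..}" using A_strict_mono[of t0 s] by (cases "s = t0") auto
  next
    fix y assume y: "y \<in> {A t0..}"
    have "eventually (\<lambda>s. A s \<ge> y \<and> s \<ge> t0) at_top"
      using A_top eventually_ge_at_top[of t0] unfolding filterlim_at_top by (auto intro: eventually_conj)
    from eventually_happens'[OF trivial_limit_at_top_linorder this]
    obtain s where s: "A s \<ge> y" "s \<ge> t0" by blast
    have "\<exists>r\<ge>t0. r \<le> s \<and> A r = y"
      by (rule IVT') (use s y in \<open>auto intro: continuous_on_subset[OF A_cont]\<close>)
    then show "y \<in> A ` {t0..}" by auto
  qed
  have f_inv: "f y \<ge> t0 \<and> A (f y) = y" if "y \<ge> A t0" for y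
    using that f_ge[of y] A_f[of y] by (simp add: range)
  have f_top: "filterlim f at_top at_top"
    unfolding filterlim_at_top
  proof
    fix Z
    show "eventually (\<lambda>y. Z \<le> f y) at_top"
      using eventually_ge_at_top[of "max (A t0) (A (max Z t0))"]
    proof eventually_elim
      case (elim y)
      show ?case
      proof (rule ccontr)
        assume "\<not> Z \<le> f y"
        then have "A (f y) < A (max Z t0)" using f_inv[of y] elim by (intro A_strict_mono) auto
        then show False using f_inv[of y] elim by simp
      qed
    qed
  qed
  have At0: "A t0 > 0" using A_pos by simp
  have nbhd: "nbhd_of_infinity {A t0..}" unfolding nbhd_of_infinity_def by blast
  have rates: "\<And>i. i \<in> {1..n} \<Longrightarrow> eventually_const_sign (qs i)"
    "\<And>i. i \<in> {1..<n} \<Longrightarrow> ((\<lambda>t. qs (Suc i) t / qs i t) \<longlongrightarrow> 0) at_top" "slowly_oscillating (qs n)"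
    using qs_rates[OF Dq0 sign rv \<alpha>] by auto
  have ev_in: "eventually (\<lambda>y. y \<in> A ` {t0..}) at_top"
    unfolding range using eventually_ge_at_top[of "A t0"] by eventually_elim simp
  have L_qs: "eventually (\<lambda>y. qs i (f y) = L i y) at_top" if "1 \<le> i" "i \<le> n" for i
    using ev_in by eventually_elim (use L_eq that in simp)
  have "uniformly_slowly_varying (\<lambda>y. qs n (f y))"
    by (rule uniformly_slowly_varying_compose[OF rates(3) f_top])
       (rule inverse_uniformly_slowly_varying[OF A_strict_mono f_inv derA At0 posq q_small f_top])
  then have usv: "uniformly_slowly_varying (L n)"
    by (rule uniformly_slowly_varying_cong) (use L_qs n in simp)
  have signL: "eventually_const_sign (L i)" if "1 \<le> i" "i \<le> n" for i
  proof -
    have "eventually_const_sign (\<lambda>y. qs i (f y))"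
      using rates(1)[of i] that unfolding eventually_const_sign_def
      by (auto dest: eventually_compose_filterlim[OF _ f_top])
    then show ?thesis by (rule eventually_const_sign_cong) (rule L_qs[OF that])
  qed
  show sgn: "eventually_const_sign (L n)" using signL n by simp
  have derL: "eventually (\<lambda>y. (L i has_real_derivative L (Suc i) y / y) (at y)) at_top" if "i < n" for i
    using eventually_gt_at_top[of "A t0"]
  proof eventually_elim
    case (elim y)
    have "y \<in> A ` {t0..}" using elim by (simp add: range)
    with L_deriv[OF that this] L_eq[of "Suc i" y] that
    have "(L i has_real_derivative L (Suc i) y / y) (at y within {A t0..})" by (simp add: range)
    moreover have "at y within {A t0..} = at y"
      by (rule at_within_open_subset[of y "{A t0<..}"]) (use elim in auto)
    ultimately show ?case by simp
  qed
  have f_cont: "continuous_on {A t0..} f"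
    using f_deriv by (intro DERIV_continuous_on) (auto simp: range)
  \<comment> \<open>For \<open>i < n\<close> differentiability suffices; the last function gets its
    continuity from \<open>qs n\<close> composed with \<open>f\<close>.\<close>
  have contL: "continuous_on {A t0..} (L i)" if "i \<le> n" for i
  proof (cases "i = n")
    case True
    have "continuous_on {t0..} (qs n)"
      using times_cont_differentiable_on_continuous[OF qs_times_cont_differentiable[of n]] n by simp
    then have "continuous_on {A t0..} (\<lambda>y. qs n (f y))"
      by (rule continuous_on_compose2[OF _ f_cont]) (use f_inv in auto)
    then have "continuous_on {A t0..} (L n)"
      by (rule continuous_on_eq) (use L_eq[of n] n in \<open>simp add: range\<close>)
    then show ?thesis using True by simp
  next
    case False
    then show ?thesis using L_deriv[of i] that by (intro DERIV_continuous_on) (auto simp: range)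
  qed
  have meas: "measurable_fun_on {A t0..} F" if "continuous_on {A t0..} F" for F
    unfolding measurable_fun_on_def using continuous_imp_measurable_on_sets_lebesgue[OF that]
    by (auto simp: lmeasurable_iff_integrable)
  have nzL: "eventually (\<lambda>y. L n y \<noteq> 0) at_top" by (rule eventually_const_sign_nonzero[OF sgn])
  show "slowly_varying (A ` {t0..}) (\<lambda>y. \<bar>L n y\<bar>)"
    unfolding slowly_varying_def regularly_varying_def range
  proof (intro conjI allI impI nbhd meas)
    show "continuous_on {A t0..} (\<lambda>y. \<bar>L n y\<bar>)" using contL[of n] by (intro continuous_intros) simp
    show "eventually (\<lambda>y. \<bar>L n y\<bar> > 0) at_top" using nzL by eventually_elim simp
    fix x :: real assume x: "x > 0"
    have "((\<lambda>t. \<bar>L n (x * t)\<bar> / \<bar>L n t\<bar>) \<longlongrightarrow> 1) at_top"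
    proof (rule tendstoI)
      fix e :: real assume e: "e > 0"
      have "eventually (\<lambda>t. \<forall>y. min t (x * t) \<le> y \<and> y \<le> max t (x * t) \<longrightarrow> \<bar>L n y - L n t\<bar> \<le> e / 2 * \<bar>L n t\<bar>) at_top"
        using usv[unfolded uniformly_slowly_varying_def, rule_format, OF x half_gt_zero[OF e]] .
      then show "eventually (\<lambda>t. dist (\<bar>L n (x * t)\<bar> / \<bar>L n t\<bar>) 1 < e) at_top"
        using nzL
      proof eventually_elim
        case (elim t)
        have "\<bar>L n (x * t) - L n t\<bar> \<le> e / 2 * \<bar>L n t\<bar>"
          by (rule elim(1)[rule_format]) simp
        with abs_triangle_ineq3[of "L n (x * t)" "L n t"]
        have "\<bar>\<bar>L n (x * t)\<bar> - \<bar>L n t\<bar>\<bar> \<le> e / 2 * \<bar>L n t\<bar>" by (rule order_trans)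
        moreover have "\<bar>L n (x * t)\<bar> / \<bar>L n t\<bar> - 1 = (\<bar>L n (x * t)\<bar> - \<bar>L n t\<bar>) / \<bar>L n t\<bar>"
          using elim(2) by (simp add: field_simps)
        ultimately have "dist (\<bar>L n (x * t)\<bar> / \<bar>L n t\<bar>) 1 \<le> e / 2"
          using elim(2) by (simp add: dist_real_def pos_divide_le_eq)
        then show ?case using e by simp
      qed
    qed
    then show "((\<lambda>t. \<bar>L n (x * t)\<bar> / \<bar>L n t\<bar>) \<longlongrightarrow> x powr 0) at_top" using x by simp
  qed
  have ratioL: "L (Suc (Suc i)) \<in> o[at_top](L (Suc i))" if "Suc i < n" for i
  proof (rule smalloI_tendsto)
    have "((\<lambda>y. qs (Suc (Suc i)) (f y) / qs (Suc i) (f y)) \<longlongrightarrow> 0) at_top"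
      using rates(2)[of "Suc i"] that by (intro filterlim_compose[OF _ f_top]) simp
    moreover have "eventually (\<lambda>y. qs (Suc (Suc i)) (f y) / qs (Suc i) (f y) = L (Suc (Suc i)) y / L (Suc i) y) at_top"
      using L_qs[of "Suc i"] L_qs[of "Suc (Suc i)"] that by (auto elim: eventually_elim2)
    ultimately show "((\<lambda>y. L (Suc (Suc i)) y / L (Suc i) y) \<longlongrightarrow> 0) at_top"
      by (rule Lim_transform_eventually)
    show "eventually (\<lambda>y. L (Suc i) y \<noteq> 0) at_top"
      using signL[of "Suc i"] that by (intro eventually_const_sign_nonzero) simp
  qed
  have nSuc: "Suc (n - 1) = n" "n - 1 < n" using n by auto
  let ?g = "\<lambda>y. vec n (\<lambda>i. L (Suc i) y)"
  have rate: "rate_vector n {A t0..} ?g"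
    unfolding rate_vector_def using n nbhd signL ratioL by auto
  have expand: "(\<lambda>t. (?g (x * t) - powr_mat x (jordan_block n 0) *\<^sub>v ?g t) $ i) \<in> o[at_top](\<lambda>t. ?g t $ (n - 1))"
    if "x > 0" "i < n" for x i
  proof -
    have "(?g (x * t) - powr_mat x (jordan_block n 0) *\<^sub>v ?g t) $ i =
        L (Suc i) (x * t) - (\<Sum>j\<le>n - Suc i. ln x ^ j / fact j * L (Suc i + j) t)" for t
      using that powr_mat_jordan_block_mult_vec[OF that(2)]
      by (simp add: powr_mat_def mat_exp_def)
    then show ?thesis
      using log_taylor_smallo[OF derL usv _ that(1), of "Suc i"] that nSuc by simp
  qed
  have rvv: "regularly_varying_vec n {A t0..} ?g (jordan_block n 0)"
    unfolding regularly_varying_vec_def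
    using rate index_matrix_jordan_block expand meas[OF contL] by simp
  have f_L0: "(\<lambda>t. f (x * t) - f t - Pi_h (unit_vec n 0) (jordan_block n 0) x \<bullet> ?g t) \<in> o[at_top](\<lambda>t. ?g t $ (n - 1))"
    if x: "x > 0" for x
  proof -
    \<comment> \<open>\<open>L 0\<close> is tied to \<open>f\<close> on the range of
      \<open>A\<close>, hence the restriction to large \<open>t\<close>. Splitting off the term
      \<open>j = 0\<close> of the Taylor polynomial leaves the product with
      \<open>h(x)\<close>.\<close>
    have "eventually (\<lambda>t. L 0 (x * t) - (\<Sum>j\<le>n - 0. ln x ^ j / fact j * L (0 + j) t) =
        f (x * t) - f t - Pi_h (unit_vec n 0) (jordan_block n 0) x \<bullet> ?g t) at_top"
      using ev_in eventually_scaled_at_top[OF ev_in x]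
    proof eventually_elim
      case (elim t)
      have "(\<Sum>j\<le>n. ln x ^ j / fact j * L j t) = L 0 t + (\<Sum>j<n. ln x ^ Suc j / fact (Suc j) * L (Suc j) t)"
        by (simp add: lessThan_Suc_atMost[symmetric] sum.lessThan_Suc_shift del: sum.lessThan_Suc fact_Suc power_Suc)
      then show ?case using L_0 elim Pi_h_jordan_block[OF n x] by simp
    qed
    then show ?thesis
      using log_taylor_smallo[OF derL usv _ x, of 0] nSuc
      by (simp add: landau_o.small.in_cong)
  qed
  show "Pi_class n (A ` {t0..}) f (A ` {t0..}) ?g (jordan_block n 0) (unit_vec n 0)"
    unfolding Pi_class_def range using rvv nbhd meas[OF f_cont] f_L0 by simp
qed

end

theorem theorem6p4:
  fixes n :: nat and t0 :: real
    and q A f :: "real \<Rightarrow> real"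
    and L qs :: "nat \<Rightarrow> real \<Rightarrow> real"
  assumes n: "n \<ge> 1"
    and q_cont: "continuous_on {t0..} q"
    and q_pos: "\<forall>t\<ge>t0. q t > 0"
    and A_pos: "\<forall>t\<ge>t0. A t > 0"
    and A_eq: "\<forall>t\<ge>t0. A t = A t0 * exp (integral {t0..t} (\<lambda>s. 1 / q s))"
    and f_eq: "\<forall>y\<in>A ` {t0..}. f y = inv_into {t0..} A y"
    and q_diff: "times_cont_differentiable_on (n - 1) {t0..} q"
    and L_0: "\<forall>y\<in>A ` {t0..}. L 0 y = f y"
    and L_step: "\<forall>i\<in>{1..n}. \<forall>y\<in>A ` {t0..}. L i y = y * deriv_on (A ` {t0..}) (L (i - 1)) y"
    and q_1: "\<forall>t\<ge>t0. qs 1 t = q t"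
    and q_step: "\<forall>i\<in>{2..n}. \<forall>t\<ge>t0. qs i t = q t * deriv_on {t0..} (qs (i - 1)) t"
  shows
    "inj_on A {t0..} \<and>
     (\<forall>i\<in>{1..n}. L (i - 1) differentiable_on A ` {t0..}) \<and>
     (\<forall>i\<in>{2..n}. qs (i - 1) differentiable_on {t0..}) \<and>
     (\<forall>i\<in>{1..n}. \<forall>y\<in>A ` {t0..}. L i y = qs i (f y)) \<and>
     (\<forall>\<alpha>::real.
        eventually (\<lambda>t. q differentiable (at t)) at_top \<and>
        deriv_on {t0..} q \<in> o[at_top](\<lambda>t. 1) \<and>
        eventually_const_sign ((deriv_on {t0..} ^^ (n - 1)) q) \<and>
        \<alpha> \<le> 1 \<and>
        regularly_varying {t0..} (\<lambda>t. \<bar>(deriv_on {t0..} ^^ (n - 1)) q t\<bar>) (\<alpha> - real n + 1) \<and>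
        \<not> (\<exists>m\<in>{2..n - 1}. \<alpha> = (real m - 1) / real m)
        \<longrightarrow>
        eventually_const_sign (L n) \<and>
        slowly_varying (A ` {t0..}) (\<lambda>y. \<bar>L n y\<bar>) \<and>
        Pi_class n (A ` {t0..}) f (A ` {t0..}) (\<lambda>y. vec n (\<lambda>i. L (Suc i) y))
          (jordan_block n 0) (unit_vec n 0))"
proof -
  interpret iterated_log_derivatives t0 q A f n L qs
    by unfold_locales (use n q_cont q_pos A_pos A_eq f_eq q_diff L_0 L_step q_1 q_step in blast)+
  show ?thesis
  proof (intro conjI ballI allI impI)
    show "inj_on A {t0..}" by (rule A_inj)
  next
    fix i assume "i \<in> {1..n}"
    then show "L (i - 1) differentiable_on A ` {t0..}"
      using L_deriv[of "i - 1"] unfolding differentiable_on_def real_differentiable_def by fastforce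
  next
    fix i assume "i \<in> {2..n}"
    then show "qs (i - 1) differentiable_on {t0..}" by (intro qs_differentiable) auto
  next
    fix i y assume "i \<in> {1..n}" "y \<in> A ` {t0..}"
    then show "L i y = qs i (f y)" by (intro L_eq) auto
  qed (use Pi_class_f in blast)+
qed

end
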